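(* Let $\mathcal{L}$ be a fixed homogeneous three-variable linear equation, i.e. $a_1x_1+a_2x_2+a_3x_3=0$ with $a_1,a_2,a_3$ nonzero integers. Then $$f_{\max}(n,\mathcal{L})\leq 3^{(\mu_{\mathcal{L}}(n)-\mu^*_{\mathcal{L}}(n))/3+o(n)}.$$
   Context: $[n]=\{1,\dots,n\}$. A solution $(x_1,x_2,x_3)$ to $\mathcal{L}$ is trivial if there is a partition $P_1,\dots,P_\ell$ of $\{1,2,3\}$ such that $x_i=x_j$ whenever $i,j$ lie in the same class, and $\sum_{i\in P_r}a_i=0$ for every $r$. A set $A\subseteq[n]$ is $\mathcal{L}$-free if it contains no non-trivial solution to $\mathcal{L}$ (entries of a solution need not be distinct). A set $S\subseteq[n]$ is a maximal $\mathcal{L}$-free subset of $[n]$ if it is $\mathcal{L}$-free and not properly contained in another $\mathcal{L}$-free subset of $[n]$; $f_{\max}(n,\mathcal{L})$ is the number of these. $\mu_{\mathcal{L}}(n)$ is the size of the largest $\mathcal{L}$-free subset of $[n]$. An $\mathcal{L}$-triple is a multiset $\{x,y,z\}$ which (in some order) forms a solution to $\mathcal{L}$, trivial or not. $\mu^*_{\mathcal{L}}(n)$ is the number of elements $x\in[n]$ that do not lie in any $\mathcal{L}$-triple contained in $[n]$. The $o(n)$ term is as $n\to\infty$ with $\mathcal{L}$ fixed. *)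

theory Defs
  imports
    "HOL-Analysis.Analysis"
    "HOL-Library.Landau_Symbols"
    "HOL-Library.Multiset"
    "HOL-Library.Disjoint_Sets"
begin

text \<open>
  A homogeneous three-variable linear equation is given by its coefficient vector
  \<open>a :: int ^ 3\<close>, and a candidate solution is a vector \<open>x :: nat ^ 3\<close>. Natural number
  entries suffice, as only solutions with all entries in \<open>{1..n}\<close> are ever considered.
\<close>

definition is_solution :: "int ^ 3 \<Rightarrow> nat ^ 3 \<Rightarrow> bool" where
  "is_solution a x \<longleftrightarrow> (\<Sum>i\<in>UNIV. a $ i * int (x $ i)) = 0"

definition trivial_solution :: "int ^ 3 \<Rightarrow> nat ^ 3 \<Rightarrow> bool" where
  "trivial_solution a x \<longleftrightarrow> is_solution a x \<and>
     (\<exists>\<P>. partition_on (UNIV :: 3 set) \<P> \<and>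
        (\<forall>P\<in>\<P>. (\<forall>i\<in>P. \<forall>j\<in>P. x $ i = x $ j) \<and> (\<Sum>i\<in>P. a $ i) = 0))"

definition eq_free :: "int ^ 3 \<Rightarrow> nat set \<Rightarrow> bool" where
  "eq_free a A \<longleftrightarrow>
     \<not> (\<exists>x. (\<forall>i. x $ i \<in> A) \<and> is_solution a x \<and> \<not> trivial_solution a x)"

definition maximal_eq_free :: "int ^ 3 \<Rightarrow> nat \<Rightarrow> nat set \<Rightarrow> bool" where
  "maximal_eq_free a n S \<longleftrightarrow> S \<subseteq> {1..n} \<and> eq_free a S \<and>
     \<not> (\<exists>T. T \<subseteq> {1..n} \<and> eq_free a T \<and> S \<subset> T)"

definition f_max :: "nat \<Rightarrow> int ^ 3 \<Rightarrow> nat" where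
  "f_max n a = card {S. maximal_eq_free a n S}"

definition mu :: "int ^ 3 \<Rightarrow> nat \<Rightarrow> nat" where
  "mu a n = Max {card A |A. A \<subseteq> {1..n} \<and> eq_free a A}"

definition eq_triple :: "int ^ 3 \<Rightarrow> nat multiset \<Rightarrow> bool" where
  "eq_triple a M \<longleftrightarrow> (\<exists>x. is_solution a x \<and> M = {#x $ 1, x $ 2, x $ 3#})"

definition mu_star :: "int ^ 3 \<Rightarrow> nat \<Rightarrow> nat" where
  "mu_star a n =
     card {x \<in> {1..n}. \<not> (\<exists>M. eq_triple a M \<and> set_mset M \<subseteq> {1..n} \<and> x \<in># M)}"

end

theory Submission
  imports Defs "HOL-Real_Asymp.Real_Asymp"
begin

text \<open>
  Iterating a graph-container argument shows that all \<open>\<L>\<close>-free subsets of \<open>[n]\<close> are covered by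
  \<open>2\<^sup>o\<^sup>(\<^sup>n\<^sup>)\<close> containers that span only \<open>o(n\<^sup>2)\<close> solutions. The removal lemma for \<open>\<L>\<close>, a consequence of
  triangle removal, splits each container into a set \<open>R\<close> of size \<open>o(n)\<close> and a solution-free set \<open>B\<close>.
  For a fixed trace \<open>S\<close> on \<open>R\<close>, the maximal \<open>\<L>\<close>-free sets in the container correspond to maximal
  independent sets of the graph on \<open>B\<close> joining \<open>y\<close> and \<open>z\<close> if \<open>S \<union> {y, z}\<close> is not \<open>\<L>\<close>-free. The elements
  counted by \<open>mu_star\<close> lie in every maximal \<open>\<L>\<close>-free set, and \<open>B\<close> together with them is still
  \<open>\<L>\<close>-free, so at most \<open>\<mu> - \<mu>\<^sup>*\<close> vertices matter, and the Moon-Moser bound \<open>3\<^sup>m\<^sup>/\<^sup>3\<close> applies.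
\<close>

subsection \<open>Maximal independent sets\<close>

text \<open>Deleting \<open>R\<close> turns a 3-uniform hypergraph into a graph: every solution
  inside a container meets \<open>R\<close>, so a fixed trace on \<open>R\<close> leaves at most two
  entries free. This is essential for the base, since the Moon-Moser bound fails for 3-uniform
  hypergraphs: the complete one on five vertices has ten maximal independent sets. When the
  coefficients sum to 0, every diagonal triple is a solution, so
  \<open>solutions a (F - R) = {}\<close> forces \<open>R = F\<close>. The removal lemma then
  contains a theorem of Roth type: for large n the containers have o(n) elements, and the factor
  \<open>2 ^ card R\<close> for the traces carries the whole count. For any other coefficient sum,
  all solutions are nontrivial. Fingerprints of size O(sqrt n) suffice in the container argument, so
  there are only exp(O(sqrt n log n)) containers; the size of the o(n) term is governed by the
  removal lemma.\<close>

definition max_indep :: "('a \<Rightarrow> 'a \<Rightarrow> bool) \<Rightarrow> 'a set \<Rightarrow> 'a set set" where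
  "max_indep E W = {X. X \<subseteq> W \<and> (\<forall>x\<in>X. \<forall>y\<in>X. \<not> E x y) \<and> (\<forall>v\<in>W - X. \<exists>y\<in>X. E v y)}"

lemma finite_max_indep: "finite W \<Longrightarrow> finite (max_indep E W)"
  by (rule finite_subset[of _ "Pow W"]) (auto simp: max_indep_def)

lemma cube_le_power3: "(k::nat) ^ 3 \<le> 3 ^ k"
proof -
  have "k ^ 3 \<le> 3 ^ k" if "k \<ge> 3" using that
  proof (induction k rule: dec_induct)
    case (step k)
    have "9 \<le> k * k" using mult_le_mono[OF step(1) step(1)] by simp
    moreover have "3 * k \<le> k * k" "3 * (k * k) \<le> k * (k * k)" using step(1) by simp_all
    ultimately have "3 * (k * k) + 3 * k + 1 \<le> 2 * (k * (k * k))" by linarith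
    then show ?case
      using step(3) by (simp add: power3_eq_cube algebra_simps)
  qed simp
  moreover have "k = 0 \<or> k = 1 \<or> k = 2" if "\<not> k \<ge> 3" using that by arith
  ultimately show ?thesis by fastforce
qed

text \<open>Over the positive integers, k^(1/k) is largest at k = 3. This is the origin of both
  threes in the Moon-Moser bound, which disjoint triangles attain.\<close>

lemma nat_le_3_powr: "real k \<le> 3 powr (real k / 3)"
proof -
  have "real k ^ 3 \<le> 3 ^ k"
    using cube_le_power3[of k] by (metis of_nat_le_iff of_nat_numeral of_nat_power)
  also have "\<dots> = (3 powr (real k / 3)) ^ 3"
    by (simp add: powr_power powr_realpow)
  finally show ?thesis
    by (simp add: power_mono_iff)
qed

theorem card_max_indep_le:
  assumes "finite W" and "\<And>x y. E x y \<Longrightarrow> E y x" and "\<And>x. x \<in> W \<Longrightarrow> \<not> E x x"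
  shows "real (card (max_indep E W)) \<le> 3 powr (real (card W) / 3)"
  using assms(1,3)
proof (induction "card W" arbitrary: W rule: less_induct)
  case less
  show ?case
  proof (cases "W = {}")
    case True
    then have "max_indep E W = {{}}" by (auto simp: max_indep_def)
    then show ?thesis using True by simp
  next
    case False
    \<comment> \<open>\<open>v\<close> has minimum degree. Every maximal independent set meets the closed neighbourhood of \<open>v\<close>,
      and deleting the closed neighbourhood of any of its vertices removes at least \<open>card (nb v)\<close> vertices.\<close>
    define nb where "nb w = insert w {y \<in> W. E w y}" for w
    define v where "v = arg_min_on (\<lambda>w. card (nb w)) W"
    have v: "v \<in> W" "\<And>w. w \<in> W \<Longrightarrow> card (nb v) \<le> card (nb w)"
      unfolding v_def using arg_min_if_finite[OF less(2) False] arg_min_least[OF less(2) False] by auto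
    have nbW: "nb w \<subseteq> W" if "w \<in> W" for w using that by (auto simp: nb_def)
    have fin: "finite (nb w)" if "w \<in> W" for w using nbW[OF that] less(2) finite_subset by auto
    let ?k = "card (nb v)"
    have sub: "max_indep E W \<subseteq> (\<Union>w\<in>nb v. insert w ` max_indep E (W - nb w))"
    proof
      fix X assume X: "X \<in> max_indep E W"
      have "\<exists>w\<in>nb v. w \<in> X"
      proof (cases "v \<in> X")
        case False
        then obtain y where "y \<in> X" "E v y" "y \<in> W" using X v(1) unfolding max_indep_def by blast
        then show ?thesis by (auto simp: nb_def)
      qed (auto simp: nb_def)
      then obtain w where w: "w \<in> nb v" "w \<in> X" by auto
      \<comment> \<open>By symmetry of \<open>E\<close>, a vertex outside \<open>nb w\<close> is not
        dominated by \<open>w\<close>, so whatever dominates it in \<open>X\<close> survives in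
        \<open>X - {w}\<close>.\<close>
      have "X - {w} \<in> max_indep E (W - nb w)"
        using X w(2) assms(2) unfolding max_indep_def nb_def by blast
      then have "X \<in> insert w ` max_indep E (W - nb w)"
        using w(2) by (metis image_eqI insert_Diff)
      then show "X \<in> (\<Union>w\<in>nb v. insert w ` max_indep E (W - nb w))" using w by blast
    qed
    have bound: "real (card (insert w ` max_indep E (W - nb w))) \<le> 3 powr ((real (card W) - real ?k) / 3)"
      if "w \<in> nb v" for w
    proof -
      have wW: "w \<in> W" using that v nbW by auto
      have c: "card (W - nb w) = card W - card (nb w)"
        using nbW[OF wW] fin[OF wW] by (simp add: card_Diff_subset)
      have "card (nb w) \<le> card W" using nbW[OF wW] less(2) card_mono by auto
      moreover have "card (nb w) > 0" using fin[OF wW] by (auto simp: card_gt_0_iff nb_def)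
      ultimately have "card (W - nb w) < card W" using c by auto
      then have "real (card (max_indep E (W - nb w))) \<le> 3 powr (real (card (W - nb w)) / 3)"
        using less by auto
      also have "\<dots> \<le> 3 powr ((real (card W) - real ?k) / 3)"
        using v(2)[OF wW] c \<open>card (nb w) \<le> card W\<close> by auto
      finally show ?thesis
        using card_image_le[OF finite_max_indep[of "W - nb w" E], of "insert w"] less(2)
        by (smt (verit) finite_Diff of_nat_mono)
    qed
    have "real (card (max_indep E W)) \<le> real (card (\<Union>w\<in>nb v. insert w ` max_indep E (W - nb w)))"
      using sub fin[OF v(1)] less(2) by (intro of_nat_mono card_mono) (auto simp: finite_max_indep)
    also have "\<dots> \<le> (\<Sum>w\<in>nb v. real (card (insert w ` max_indep E (W - nb w))))"
      using card_UN_le[OF fin[OF v(1)], of "\<lambda>w. insert w ` max_indep E (W - nb w)"]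
      unfolding of_nat_sum[symmetric] of_nat_le_iff .
    also have "\<dots> \<le> (\<Sum>w\<in>nb v. 3 powr ((real (card W) - real ?k) / 3))"
      by (intro sum_mono bound)
    also have "\<dots> \<le> 3 powr (real ?k / 3) * 3 powr ((real (card W) - real ?k) / 3)"
      using nat_le_3_powr[of ?k] by simp
    also have "\<dots> = 3 powr (real (card W) / 3)"
      by (simp add: diff_divide_distrib flip: powr_add)
    finally show ?thesis .
  qed
qed

subsection \<open>Regularity\<close>

definition cell :: "'a set \<Rightarrow> ('a \<Rightarrow> 'k) \<Rightarrow> 'a \<Rightarrow> 'a set" where
  "cell V k x = {y \<in> V. k y = k x}"

text \<open>This is the conditional expectation of \<open>f\<close> given the partition of
  \<open>V\<close> into the fibres of \<open>k\<close>.\<close>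

definition avg :: "'a set \<Rightarrow> ('a \<Rightarrow> 'k) \<Rightarrow> ('a \<Rightarrow> real) \<Rightarrow> 'a \<Rightarrow> real" where
  "avg V k f x = (\<Sum>y\<in>cell V k x. f y) / real (card (cell V k x))"

lemma cell_eq: "k x = k y \<Longrightarrow> cell V k x = cell V k y"
  by (auto simp: cell_def)

lemma cell_subset: "cell V k x \<subseteq> V"
  by (auto simp: cell_def)

lemma cell_self: "x \<in> V \<Longrightarrow> x \<in> cell V k x"
  by (auto simp: cell_def)

lemma finite_cell: "finite V \<Longrightarrow> finite (cell V k x)"
  by (simp add: cell_def)

lemma card_cell_pos: "finite V \<Longrightarrow> x \<in> V \<Longrightarrow> card (cell V k x) > 0"
  using cell_self[of x V k] finite_cell[of V k x] by (auto simp: card_gt_0_iff)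

lemma avg_eq: "k x = k y \<Longrightarrow> avg V k f x = avg V k f y"
  by (simp add: avg_def cell_eq[of k x y])

text \<open>Both sums agree cell by cell, because \<open>g\<close> is constant on each cell.
  Expanding the average gives a sum over pairs in a common cell, where the order of summation is
  exchanged.\<close>

lemma sum_avg_mult:
  assumes "finite V" and g: "\<And>x y. x \<in> V \<Longrightarrow> y \<in> V \<Longrightarrow> k x = k y \<Longrightarrow> g x = g y"
  shows "(\<Sum>x\<in>V. avg V k f x * g x) = (\<Sum>x\<in>V. f x * g x)"
proof -
  have "(\<Sum>x\<in>V. avg V k f x * g x)
      = (\<Sum>x\<in>V. \<Sum>y\<in>V. if k y = k x then f y * g y / real (card (cell V k y)) else 0)"
  proof (intro sum.cong refl)
    fix x assume x: "x \<in> V"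
    have "avg V k f x * g x = (\<Sum>y\<in>cell V k x. f y * g x / real (card (cell V k x)))"
      by (simp add: avg_def sum_distrib_right sum_divide_distrib)
    also have "\<dots> = (\<Sum>y\<in>cell V k x. f y * g y / real (card (cell V k y)))"
      using x by (intro sum.cong refl) (auto simp: cell_def intro: g)
    also have "\<dots> = (\<Sum>y\<in>V. if k y = k x then f y * g y / real (card (cell V k y)) else 0)"
      by (simp only: cell_def[of V k x] sum.inter_filter assms(1))
    finally show "avg V k f x * g x = \<dots>" .
  qed
  also have "\<dots> = (\<Sum>y\<in>V. \<Sum>x\<in>V. if k y = k x then f y * g y / real (card (cell V k y)) else 0)"
    by (rule sum.swap)
  also have "\<dots> = (\<Sum>y\<in>V. f y * g y)"
  proof (intro sum.cong refl)
    fix y assume y: "y \<in> V"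
    have "(\<Sum>x\<in>V. if k y = k x then f y * g y / real (card (cell V k y)) else 0)
        = (\<Sum>x\<in>{x\<in>V. k y = k x}. f y * g y / real (card (cell V k y)))"
      by (rule sum.inter_filter[symmetric]) (fact assms(1))
    also have "{x\<in>V. k y = k x} = cell V k y"
      by (auto simp: cell_def)
    finally show "(\<Sum>x\<in>V. if k y = k x then f y * g y / real (card (cell V k y)) else 0) = f y * g y"

      using card_cell_pos[OF assms(1) y, of k] by simp
  qed
  finally show ?thesis .
qed

text \<open>Averaging is an orthogonal projection: the coarse average is constant on the finer
  cells, so the cross term equals the squared norm of the coarse average. The energy gained by a
  refinement is therefore exactly a squared distance.\<close>

lemma avg_pythagoras:
  assumes "finite V" and "\<And>x y. k' x = k' y \<Longrightarrow> k x = k y"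
  shows "(\<Sum>x\<in>V. (avg V k' f x)\<^sup>2)
       = (\<Sum>x\<in>V. (avg V k f x)\<^sup>2) + (\<Sum>x\<in>V. (avg V k' f x - avg V k f x)\<^sup>2)"
proof -
  have "(\<Sum>x\<in>V. avg V k' f x * avg V k f x) = (\<Sum>x\<in>V. f x * avg V k f x)"
    by (rule sum_avg_mult[OF assms(1)], rule avg_eq[where k = k]) (rule assms(2))
  also have "\<dots> = (\<Sum>x\<in>V. avg V k f x * avg V k f x)"
    by (rule sum_avg_mult[OF assms(1), symmetric]) (rule avg_eq)
  finally have "(\<Sum>x\<in>V. avg V k' f x * avg V k f x) = (\<Sum>x\<in>V. (avg V k f x)\<^sup>2)"
    by (simp add: power2_eq_square)
  moreover have "(\<Sum>x\<in>V. (avg V k' f x - avg V k f x)\<^sup>2)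
      = (\<Sum>x\<in>V. (avg V k' f x)\<^sup>2) + (\<Sum>x\<in>V. (avg V k f x)\<^sup>2) - 2 * (\<Sum>x\<in>V. avg V k' f x * avg V k f x)"
    by (simp add: power2_diff sum.distrib sum_subtractf sum_distrib_left mult.assoc)
  ultimately show ?thesis by simp
qed

section \<open>Densities, regular pairs and energy\<close>

definition edge_density :: "('a \<times> 'a) set \<Rightarrow> 'a set \<Rightarrow> 'a set \<Rightarrow> real" where
  "edge_density G A B = real (card (G \<inter> A \<times> B)) / (real (card A) * real (card B))"

definition regular_pair :: "real \<Rightarrow> ('a \<times> 'a) set \<Rightarrow> 'a set \<Rightarrow> 'a set \<Rightarrow> bool" where
  "regular_pair \<epsilon> G A B \<longleftrightarrow>
     (\<forall>A' B'. A' \<subseteq> A \<longrightarrow> B' \<subseteq> B \<longrightarrow> \<epsilon> * real (card A) \<le> real (card A') \<longrightarrow>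
        \<epsilon> * real (card B) \<le> real (card B') \<longrightarrow> \<bar>edge_density G A' B' - edge_density G A B\<bar> \<le> \<epsilon>)"

text \<open>Partitions of the vertex set are given by finite families of sets: two vertices are
  in the same part if they lie in the same members of the family. Refining a partition
  is then enlarging the family.\<close>

definition members :: "'a set set \<Rightarrow> 'a \<Rightarrow> 'a set set" where
  "members \<W> x = {S \<in> \<W>. x \<in> S}"

lemma members_eqD: "members \<W> x = members \<W> y \<Longrightarrow> S \<in> \<W> \<Longrightarrow> x \<in> S \<longleftrightarrow> y \<in> S"
  unfolding members_def by blast

text \<open>Labelling pairs makes products of cells into cells of \<open>V \<times> V\<close>. The
  averages of the indicator of \<open>G\<close> are then the densities between cells, and the
  averaging lemmas apply to them.\<close>

definition members2 :: "'a set set \<Rightarrow> 'a \<times> 'a \<Rightarrow> 'a set set \<times> 'a set set" where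
  "members2 \<W> p = (members \<W> (fst p), members \<W> (snd p))"

text \<open>This is the mean square density without normalisation; summing over vertex pairs weights
  each pair of parts by its size.\<close>

definition energy :: "'a set \<Rightarrow> ('a \<times> 'a) set \<Rightarrow> 'a set set \<Rightarrow> real" where
  "energy V G \<W> = (\<Sum>p\<in>V \<times> V. (avg (V \<times> V) (members2 \<W>) (indicator G) p)\<^sup>2)"

text \<open>Irregularity is measured by vertex pairs and not by pairs of parts, so the parts may
  have very different sizes.\<close>

definition irregular :: "real \<Rightarrow> 'a set \<Rightarrow> ('a \<times> 'a) set \<Rightarrow> 'a set set \<Rightarrow> ('a \<times> 'a) set" where
  "irregular \<epsilon> V G \<W> =
     {p \<in> V \<times> V. \<not> regular_pair \<epsilon> G (cell V (members \<W>) (fst p)) (cell V (members \<W>) (snd p))}"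

lemma cell_members2: "cell (V \<times> V) (members2 \<W>) (x, y) = cell V (members \<W>) x \<times> cell V (members \<W>) y"
  by (auto simp: cell_def members2_def)

lemma avg_members2:
  assumes "finite V"
  shows "avg (V \<times> V) (members2 \<W>) (indicator G) (x, y)
       = edge_density G (cell V (members \<W>) x) (cell V (members \<W>) y)"
proof -
  have fin: "finite (cell (V \<times> V) (members2 \<W>) (x, y))"
    using assms by (simp add: finite_cell)
  have "avg (V \<times> V) (members2 \<W>) (indicator G) (x, y)
      = real (card (cell (V \<times> V) (members2 \<W>) (x, y) \<inter> G)) / real (card (cell (V \<times> V) (members2 \<W>) (x, y)))"
    unfolding avg_def indicator_def using fin by (simp add: Int_def)
  then show ?thesis
    by (simp add: cell_members2 edge_density_def card_cartesian_product Int_commute)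
qed

lemma edge_density_nonneg: "0 \<le> edge_density G A B"
  by (simp add: edge_density_def)

lemma edge_density_le_1:
  assumes "finite A" "finite B" shows "edge_density G A B \<le> 1"
proof -
  have "real (card (G \<inter> A \<times> B)) \<le> real (card (A \<times> B))"
    using assms by (intro of_nat_mono card_mono) auto
  then have le: "real (card (G \<inter> A \<times> B)) \<le> 1 * (real (card A) * real (card B))"
    by (simp add: card_cartesian_product)
  show ?thesis
  proof (cases "real (card A) * real (card B) = 0")
    case True then show ?thesis by (simp only: edge_density_def True) simp
  next
    case False
    then have "real (card A) * real (card B) > 0" by (simp add: zero_less_mult_iff)
    then show ?thesis unfolding edge_density_def using le by (rule mult_imp_div_pos_le)
  qed
qed

lemma energy_le:
  assumes "finite V" shows "energy V G \<W> \<le> (real (card V))\<^sup>2"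
proof -
  have "energy V G \<W> \<le> (\<Sum>p\<in>V \<times> V. 1)"
    unfolding energy_def
  proof (rule sum_mono)
    fix p assume "p \<in> V \<times> V"
    show "(avg (V \<times> V) (members2 \<W>) (indicator G) p)\<^sup>2 \<le> 1"
      using edge_density_nonneg edge_density_le_1[OF finite_cell[OF assms] finite_cell[OF assms]]
      by (cases p) (auto simp only: avg_members2[OF assms] intro!: power_le_one)
  qed
  then show ?thesis by (simp add: card_cartesian_product power2_eq_square)
qed

text \<open>On \<open>A \<times> B\<close> the coarse average is constant, while the refined one has
  mean \<open>edge_density G A B\<close>, because membership in \<open>A\<close> and
  \<open>B\<close> is determined by the labels of \<open>\<W>'\<close>. Cauchy-Schwarz turns the gap
  of more than \<open>\<epsilon>\<close> between the means into \<open>\<epsilon>\<^sup>2\<close>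
  per pair, and \<open>A \<times> B\<close> makes up at least the fraction
  \<open>\<epsilon>\<^sup>2\<close> of the product of the cells.\<close>

lemma energy_increment_pair:
  assumes fin: "finite V" and sub: "A \<subseteq> cell V (members \<W>) x" "B \<subseteq> cell V (members \<W>) y"
    and mem: "A \<in> \<W>'" "B \<in> \<W>'" and "\<epsilon> > 0"
    and A: "\<epsilon> * real (card (cell V (members \<W>) x)) \<le> real (card A)"
    and B: "\<epsilon> * real (card (cell V (members \<W>) y)) \<le> real (card B)"
    and d: "\<epsilon> < \<bar>edge_density G A B - edge_density G (cell V (members \<W>) x) (cell V (members \<W>) y)\<bar>"
  shows "\<epsilon> ^ 4 * (real (card (cell V (members \<W>) x)) * real (card (cell V (members \<W>) y)))
       \<le> (\<Sum>p\<in>A \<times> B. (avg (V \<times> V) (members2 \<W>') (indicator G) p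
                        - avg (V \<times> V) (members2 \<W>) (indicator G) p)\<^sup>2)"
proof -
  let ?X = "cell V (members \<W>) x" and ?Y = "cell V (members \<W>) y"
  let ?d = "edge_density G ?X ?Y" and ?f = "\<lambda>p. avg (V \<times> V) (members2 \<W>') (indicator G) p"
  have AV: "A \<subseteq> V" "B \<subseteq> V" using sub by (auto simp: cell_def)
  then have finAB: "finite A" "finite B" using fin finite_subset by auto
  have dd: "avg (V \<times> V) (members2 \<W>) (indicator G) p = ?d" if "p \<in> A \<times> B" for p
  proof -
    have "members \<W> (fst p) = members \<W> x" "members \<W> (snd p) = members \<W> y"
      using that sub by (auto simp: cell_def)
    then show ?thesis using avg_members2[OF fin, of \<W> G "fst p" "snd p"]
      by (metis cell_eq prod.collapse)
  qed
  have "(\<Sum>p\<in>A \<times> B. ?f p) = (\<Sum>p\<in>V \<times> V. ?f p * indicator (A \<times> B) p)"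
    using AV fin by (intro sum.mono_neutral_cong_left) (auto simp: indicator_def)
  also have "\<dots> = (\<Sum>p\<in>V \<times> V. indicator G p * indicator (A \<times> B) p)"
  proof (rule sum_avg_mult)
    fix p q :: "'a \<times> 'a" assume "members2 \<W>' p = members2 \<W>' q"
    then have "members \<W>' (fst p) = members \<W>' (fst q)" "members \<W>' (snd p) = members \<W>' (snd q)"
      by (simp_all add: members2_def)
    then have "fst p \<in> A \<longleftrightarrow> fst q \<in> A" "snd p \<in> B \<longleftrightarrow> snd q \<in> B"
      using mem members_eqD by metis+
    then have "p \<in> A \<times> B \<longleftrightarrow> q \<in> A \<times> B"
      by (simp add: mem_Times_iff)
    then show "indicat_real (A \<times> B) p = indicator (A \<times> B) q" by (simp add: indicator_def)
  qed (use fin in simp)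
  also have "\<dots> = (\<Sum>p\<in>G \<inter> A \<times> B. 1)"
    using AV fin by (intro sum.mono_neutral_cong_right) (auto simp: indicator_def)
  also have "\<dots> = real (card (G \<inter> A \<times> B))" by simp
  finally have s: "(\<Sum>p\<in>A \<times> B. ?f p) = edge_density G A B * (real (card A) * real (card B))"
  proof -
    assume *: "(\<Sum>p\<in>A \<times> B. ?f p) = real (card (G \<inter> A \<times> B))"
    show ?thesis
    proof (cases "card A = 0 \<or> card B = 0")
      case True then show ?thesis using finAB by auto
    next
      case False then show ?thesis using * by (simp add: edge_density_def)
    qed
  qed
  have "((edge_density G A B - ?d) * (real (card A) * real (card B)))\<^sup>2 = (\<Sum>p\<in>A \<times> B. ?f p - ?d)\<^sup>2"
    by (simp add: sum_subtractf s card_cartesian_product algebra_simps)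
  also have "\<dots> \<le> (\<Sum>p\<in>A \<times> B. 1\<^sup>2) * (\<Sum>p\<in>A \<times> B. (?f p - ?d)\<^sup>2)"
    using Cauchy_Schwarz_ineq_sum[of "\<lambda>_. 1" "\<lambda>p. ?f p - ?d" "A \<times> B"] by simp
  finally have "(edge_density G A B - ?d)\<^sup>2 * (real (card A) * real (card B))\<^sup>2
     \<le> (real (card A) * real (card B)) * (\<Sum>p\<in>A \<times> B. (?f p - ?d)\<^sup>2)"
    by (simp add: card_cartesian_product power_mult_distrib)
  then have le: "(edge_density G A B - ?d)\<^sup>2 * (real (card A) * real (card B)) \<le> (\<Sum>p\<in>A \<times> B. (?f p - ?d)\<^sup>2)"
  proof (cases "real (card A) * real (card B) = 0")
    case True then show ?thesis by (simp only: True mult_zero_right) (simp add: sum_nonneg)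
  next
    case False
    then have "real (card A) * real (card B) > 0" by (simp add: zero_less_mult_iff)
    moreover assume "(edge_density G A B - ?d)\<^sup>2 * (real (card A) * real (card B))\<^sup>2
     \<le> (real (card A) * real (card B)) * (\<Sum>p\<in>A \<times> B. (?f p - ?d)\<^sup>2)"
    then have "(real (card A) * real (card B)) * ((edge_density G A B - ?d)\<^sup>2 * (real (card A) * real (card B)))
     \<le> (real (card A) * real (card B)) * (\<Sum>p\<in>A \<times> B. (?f p - ?d)\<^sup>2)"
      by (simp add: power2_eq_square algebra_simps)
    ultimately show ?thesis by (simp only: mult_le_cancel_left_pos)
  qed
  have "\<epsilon>\<^sup>2 \<le> (edge_density G A B - ?d)\<^sup>2"
    using d \<open>\<epsilon> > 0\<close> by (simp flip: abs_le_square_iff)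
  then have "\<epsilon>\<^sup>2 * ((\<epsilon> * real (card ?X)) * (\<epsilon> * real (card ?Y)))
      \<le> (edge_density G A B - ?d)\<^sup>2 * (real (card A) * real (card B))"
    using A B \<open>\<epsilon> > 0\<close> by (intro mult_mono) auto
  also have "\<dots> \<le> (\<Sum>p\<in>A \<times> B. (?f p - ?d)\<^sup>2)"
    by (fact le)
  also have "(\<Sum>p\<in>A \<times> B. (?f p - ?d)\<^sup>2) = (\<Sum>p\<in>A \<times> B. (?f p - avg (V \<times> V) (members2 \<W>) (indicator G) p)\<^sup>2)"
    by (intro sum.cong refl) (simp add: dd)
  finally show ?thesis by (simp only: power2_eq_square power4_eq_xxxx ac_simps)
qed

lemma members2_in: "members2 \<W> p \<in> Pow \<W> \<times> Pow \<W>"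
  by (auto simp: members2_def members_def)

text \<open>\<open>P\<close> represents each irregular pair of parts by one vertex pair. The
  witnesses of different representatives lie in disjoint product cells, so all can be added to the
  family at once and their gains add up: \<open>\<epsilon> ^ 4\<close> on cells covering more than
  \<open>\<epsilon>\<close> of all pairs. A label of a pair consists of two subsets of
  \<open>\<W>\<close>, hence at most \<open>4 ^ card \<W>\<close> representatives with two new sets
  each.\<close>

lemma energy_increment:
  assumes V: "finite V" and W: "finite \<W>" and "\<epsilon> > 0"
    and irr: "\<epsilon> * (real (card V))\<^sup>2 < real (card (irregular \<epsilon> V G \<W>))"
  obtains \<W>' where "finite \<W>'" "card \<W>' \<le> card \<W> + 2 * 4 ^ card \<W>"
    "energy V G \<W> + \<epsilon> ^ 5 * (real (card V))\<^sup>2 \<le> energy V G \<W>'"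
proof -
  let ?c = "cell V (members \<W>)" and ?k = "members2 \<W>" and ?I = "irregular \<epsilon> V G \<W>"
  have finI: "finite ?I" using V by (auto simp: irregular_def)
  obtain P where P: "P \<subseteq> ?I" "inj_on ?k P" "?k ` ?I = ?k ` P"
    using subset_image_inj[of "?k ` ?I" ?k ?I] by auto
  have finP: "finite P" using P(1) finI finite_subset by blast
  have "card P = card (?k ` P)" using P(2) by (simp add: card_image)
  also have "\<dots> \<le> card (Pow \<W> \<times> Pow \<W>)"
    using W by (intro card_mono) (auto simp: members2_in image_subset_iff simp del: mem_Sigma_iff)
  also have "\<dots> = 4 ^ card \<W>"
    using W by (simp add: card_cartesian_product card_Pow flip: power_mult_distrib)
  finally have cardP: "card P \<le> 4 ^ card \<W>" .
  define wit where "wit p r \<longleftrightarrow> fst r \<subseteq> ?c (fst p) \<and> snd r \<subseteq> ?c (snd p) \<and>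
        \<epsilon> * real (card (?c (fst p))) \<le> real (card (fst r)) \<and>
        \<epsilon> * real (card (?c (snd p))) \<le> real (card (snd r)) \<and>
        \<epsilon> < \<bar>edge_density G (fst r) (snd r) - edge_density G (?c (fst p)) (?c (snd p))\<bar>" for p r
  have "\<exists>r. wit p r" if p: "p \<in> P" for p
  proof -
    have "\<not> regular_pair \<epsilon> G (?c (fst p)) (?c (snd p))"
      using p P(1) by (auto simp: irregular_def)
    then obtain A B where "wit p (A, B)"
      unfolding regular_pair_def wit_def fst_conv snd_conv not_all not_imp not_le by blast
    then show ?thesis by blast
  qed
  then obtain r where r: "\<And>p. p \<in> P \<Longrightarrow> wit p (r p)" by metis
  define A where "A p = fst (r p)" for p
  define B where "B p = snd (r p)" for p
  define \<W>' where "\<W>' = \<W> \<union> (A ` P \<union> B ` P)"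
  have fin': "finite \<W>'" using W finP by (simp add: \<W>'_def)
  have "card \<W>' \<le> card \<W> + (card (A ` P) + card (B ` P))"
    unfolding \<W>'_def using card_Un_le[of \<W> "A ` P \<union> B ` P"] card_Un_le[of "A ` P" "B ` P"] by linarith
  also have "\<dots> \<le> card \<W> + 2 * 4 ^ card \<W>"
    using card_image_le[OF finP, of A] card_image_le[OF finP, of B] cardP by linarith
  finally have card': "card \<W>' \<le> card \<W> + 2 * 4 ^ card \<W>" .
  let ?D = "\<lambda>p. (avg (V \<times> V) (members2 \<W>') (indicator G) p - avg (V \<times> V) ?k (indicator G) p)\<^sup>2"
  have AB: "A p \<times> B p \<subseteq> cell (V \<times> V) ?k p" if "p \<in> P" for p
    using r[OF that] by (cases p) (auto simp: cell_members2 wit_def A_def B_def)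
  have cover: "real (card ?I) \<le> real (\<Sum>p\<in>P. card (cell (V \<times> V) ?k p))"
  proof -
    have "?I \<subseteq> (\<Union>p\<in>P. cell (V \<times> V) ?k p)"
    proof
      fix q assume q: "q \<in> ?I"
      then have "?k q \<in> ?k ` P" using P(3) by blast
      then obtain p where "p \<in> P" "?k q = ?k p" by blast
      then show "q \<in> (\<Union>p\<in>P. cell (V \<times> V) ?k p)"
        using q by (auto simp: cell_def irregular_def)
    qed
    then have "card ?I \<le> card (\<Union>p\<in>P. cell (V \<times> V) ?k p)"
      using finP V by (intro card_mono) (auto intro: finite_cell)
    also have "\<dots> \<le> (\<Sum>p\<in>P. card (cell (V \<times> V) ?k p))"
      by (rule card_UN_le[OF finP])
    finally show ?thesis by (rule of_nat_mono)
  qed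
  have "\<epsilon> ^ 5 * (real (card V))\<^sup>2 = \<epsilon> ^ 4 * (\<epsilon> * (real (card V))\<^sup>2)"
    by (simp add: power_numeral_reduce)
  also have "\<dots> \<le> \<epsilon> ^ 4 * real (card ?I)"
    using irr \<open>\<epsilon> > 0\<close> by (intro mult_left_mono) auto
  also have "\<dots> \<le> \<epsilon> ^ 4 * real (\<Sum>p\<in>P. card (cell (V \<times> V) ?k p))"
    using cover by (rule mult_left_mono) simp
  also have "\<epsilon> ^ 4 * real (\<Sum>p\<in>P. card (cell (V \<times> V) ?k p))
     = (\<Sum>p\<in>P. \<epsilon> ^ 4 * (real (card (?c (fst p))) * real (card (?c (snd p)))))"
    unfolding of_nat_sum sum_distrib_left
  proof (rule sum.cong[OF refl])
    fix p show "\<epsilon> ^ 4 * real (card (cell (V \<times> V) ?k p))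
      = \<epsilon> ^ 4 * (real (card (?c (fst p))) * real (card (?c (snd p))))"
      using cell_members2[of V \<W> "fst p" "snd p"] by (simp add: card_cartesian_product)
  qed
  also have "\<dots> \<le> (\<Sum>p\<in>P. \<Sum>q\<in>A p \<times> B p. ?D q)"
  proof (rule sum_mono)
    fix p assume p: "p \<in> P"
    have "A p \<in> \<W>'" "B p \<in> \<W>'" using p by (auto simp: \<W>'_def)
    then show "\<epsilon> ^ 4 * (real (card (?c (fst p))) * real (card (?c (snd p)))) \<le> (\<Sum>q\<in>A p \<times> B p. ?D q)"
      using r[OF p] \<open>\<epsilon> > 0\<close> V unfolding wit_def A_def B_def
      by (intro energy_increment_pair) auto
  qed
  also have "\<dots> = (\<Sum>q\<in>(\<Union>p\<in>P. A p \<times> B p). ?D q)"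
  proof (rule sum.UNION_disjoint[symmetric])
    show "\<forall>p\<in>P. finite (A p \<times> B p)"
      using AB finite_cell[of "V \<times> V" ?k] V finite_subset by (metis finite_SigmaI)
    show "\<forall>p\<in>P. \<forall>q\<in>P. p \<noteq> q \<longrightarrow> A p \<times> B p \<inter> A q \<times> B q = {}"
    proof (intro ballI impI)
      fix p q assume pq: "p \<in> P" "q \<in> P" "p \<noteq> q"
      then have "?k p \<noteq> ?k q" using P(2) by (auto simp: inj_on_def)
      then have "cell (V \<times> V) ?k p \<inter> cell (V \<times> V) ?k q = {}" by (auto simp: cell_def)
      then show "A p \<times> B p \<inter> A q \<times> B q = {}" using AB[OF pq(1)] AB[OF pq(2)] by blast
    qed
  qed (fact finP)
  also have "\<dots> \<le> (\<Sum>q\<in>V \<times> V. ?D q)"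
  proof (rule sum_mono2)
    show "(\<Union>p\<in>P. A p \<times> B p) \<subseteq> V \<times> V"
      using AB cell_subset[of "V \<times> V" ?k] by blast
  qed (use V in auto)
  also have "\<dots> = energy V G \<W>' - energy V G \<W>"
  proof -
    have "?k p = ?k q" if "members2 \<W>' p = members2 \<W>' q" for p q
    proof -
      have sub: "\<W> \<subseteq> \<W>'" by (auto simp: \<W>'_def)
      have "members \<W> x = {S \<in> members \<W>' x. S \<in> \<W>}" for x
        using sub by (auto simp: members_def)
      then show ?thesis using that by (simp add: members2_def)
    qed
    then have "energy V G \<W>' = energy V G \<W> + (\<Sum>q\<in>V \<times> V. ?D q)"
      unfolding energy_def by (rule avg_pythagoras[OF finite_cartesian_product[OF V V]])
    then show ?thesis by linarith
  qed
  finally have "energy V G \<W> + \<epsilon> ^ 5 * (real (card V))\<^sup>2 \<le> energy V G \<W>'"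
    by linarith
  with fin' card' show ?thesis by (rule that)
qed

theorem regularity_lemma:
  assumes "\<epsilon> > 0"
  shows "\<exists>M. \<forall>(V :: 'a set) G. finite V \<longrightarrow> (\<exists>\<W>. finite \<W> \<and> card \<W> \<le> M \<and>
    real (card (irregular \<epsilon> V G \<W>)) \<le> \<epsilon> * (real (card V))\<^sup>2)"
proof -
  define h :: "nat \<Rightarrow> nat" where "h m = m + 2 * 4 ^ m" for m
  \<comment> \<open>The \<open>+ 1\<close> makes \<open>real N * \<epsilon> ^ 5\<close> exceed 1
    strictly, so \<open>N\<close> increments would overshoot the maximal energy. The bound on the
    family is the \<open>N\<close>-fold iterate of \<open>h\<close> and does not depend on
    \<open>V\<close>.\<close>
  define N where "N = nat \<lceil>1 / \<epsilon> ^ 5\<rceil> + 1"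
  have N: "1 < real N * \<epsilon> ^ 5"
  proof -
    have "1 / \<epsilon> ^ 5 < real N" unfolding N_def by linarith
    then show ?thesis using assms by (simp add: field_simps)
  qed
  have h_mono: "i \<le> j \<Longrightarrow> (h ^^ i) 0 \<le> (h ^^ j) 0" for i j
    by (rule lift_Suc_mono_le[of "\<lambda>i. (h ^^ i) 0"]) (simp_all add: h_def)
  have h_le: "m \<le> n \<Longrightarrow> h m \<le> h n" for m n
    unfolding h_def by (intro add_mono mult_le_mono2 power_increasing) auto
  have "\<exists>\<W>. finite \<W> \<and> card \<W> \<le> (h ^^ N) 0 \<and>
    real (card (irregular \<epsilon> V G \<W>)) \<le> \<epsilon> * (real (card V))\<^sup>2"
    if V: "finite V" for V :: "'a set" and G
  proof (rule ccontr)
    assume "\<nexists>\<W>. finite \<W> \<and> card \<W> \<le> (h ^^ N) 0 \<and>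
      real (card (irregular \<epsilon> V G \<W>)) \<le> \<epsilon> * (real (card V))\<^sup>2"
    then have bad: "\<epsilon> * (real (card V))\<^sup>2 < real (card (irregular \<epsilon> V G \<W>))"
      if "finite \<W>" "card \<W> \<le> (h ^^ N) 0" for \<W>
      using that by (meson not_le)
    have "V \<noteq> {}" using bad[of "{}"] by (auto simp: irregular_def)
    then have Vpos: "(real (card V))\<^sup>2 > 0" using V by (simp add: card_gt_0_iff)
    have "\<exists>\<W>. finite \<W> \<and> card \<W> \<le> (h ^^ i) 0 \<and> real i * \<epsilon> ^ 5 * (real (card V))\<^sup>2 \<le> energy V G \<W>"
      if "i \<le> N" for i using that
    proof (induction i)
      case 0
      show ?case by (intro exI[of _ "{}"]) (simp add: energy_def sum_nonneg)
    next
      case (Suc i)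
      then obtain \<W> where W: "finite \<W>" "card \<W> \<le> (h ^^ i) 0"
        "real i * \<epsilon> ^ 5 * (real (card V))\<^sup>2 \<le> energy V G \<W>" by auto
      have "card \<W> \<le> (h ^^ N) 0" using W(2) h_mono[of i N] Suc.prems by linarith
      from energy_increment[OF V W(1) assms bad[OF W(1) this]]
      obtain \<W>' where W': "finite \<W>'" "card \<W>' \<le> h (card \<W>)"
        "energy V G \<W> + \<epsilon> ^ 5 * (real (card V))\<^sup>2 \<le> energy V G \<W>'"
        unfolding h_def .
      have "card \<W>' \<le> (h ^^ Suc i) 0" using W'(2) h_le[OF W(2)] by simp
      moreover have "real (Suc i) * \<epsilon> ^ 5 * (real (card V))\<^sup>2 \<le> energy V G \<W>'"
        using W(3) W'(3) by (simp add: algebra_simps)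
      ultimately show ?case using W'(1) by blast
    qed
    from this[of N] obtain \<W> where "real N * \<epsilon> ^ 5 * (real (card V))\<^sup>2 \<le> energy V G \<W>" by auto
    also have "\<dots> \<le> 1 * (real (card V))\<^sup>2" using energy_le[OF V] by simp
    finally have "real N * \<epsilon> ^ 5 \<le> 1" using Vpos by (simp only: mult_le_cancel_right_pos)
    then show False using N by simp
  qed
  then show ?thesis by blast
qed

subsection \<open>Triangle removal\<close>

text \<open>Edges are directed and a triangle is a transitive triple. In the layered graph of the
  application all edges go to a later layer, so no symmetrisation is required.\<close>

definition triangles :: "('a \<times> 'a) set \<Rightarrow> ('a \<times> 'a \<times> 'a) set" where
  "triangles G = {(x, y, z). (x, y) \<in> G \<and> (y, z) \<in> G \<and> (x, z) \<in> G}"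

lemma regular_pair_edges:
  assumes "regular_pair \<epsilon> G A B" "2 * \<epsilon> \<le> edge_density G A B"
    and "A' \<subseteq> A" "B' \<subseteq> B" "\<epsilon> * real (card A) \<le> real (card A')" "\<epsilon> * real (card B) \<le> real (card B')"
  shows "\<epsilon> * (real (card A') * real (card B')) \<le> real (card (G \<inter> A' \<times> B'))"
proof (cases "real (card A') * real (card B') = 0")
  case False
  have "\<bar>edge_density G A' B' - edge_density G A B\<bar> \<le> \<epsilon>"
    using assms unfolding regular_pair_def by blast
  then have "\<epsilon> \<le> edge_density G A' B'" using assms(2) by linarith
  moreover have "real (card A') * real (card B') > 0" using False by (simp add: zero_less_mult_iff)
  ultimately show ?thesis unfolding edge_density_def by (simp only: pos_le_divide_eq)
next
  case True
  then show ?thesis by (simp only: True mult_zero_right of_nat_0_le_iff)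
qed

text \<open>If the vertices of low degree made up an \<open>\<epsilon>\<close>-fraction of
  \<open>A\<close>, they would span with \<open>B\<close> a density below \<open>\<epsilon>\<close>,
  although regularity keeps it within \<open>\<epsilon>\<close> of a density of at least
  \<open>2 * \<epsilon>\<close>.\<close>

lemma card_low_degree_less:
  assumes "regular_pair \<epsilon> G A B" "2 * \<epsilon> \<le> edge_density G A B"
    and fin: "finite A" "finite B" "A \<noteq> {}" "B \<noteq> {}" and \<epsilon>: "0 < \<epsilon>" "\<epsilon> \<le> 1"
  shows "real (card {x \<in> A. real (card (G `` {x} \<inter> B)) < \<epsilon> * real (card B)}) < \<epsilon> * real (card A)"
proof (rule ccontr)
  let ?L = "{x \<in> A. real (card (G `` {x} \<inter> B)) < \<epsilon> * real (card B)}"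
  assume "\<not> ?thesis"
  then have L: "\<epsilon> * real (card A) \<le> real (card ?L)" by simp
  have "\<epsilon> * real (card A) > 0" using fin \<epsilon> by (simp add: card_gt_0_iff)
  then have Lne: "?L \<noteq> {}" using L by (metis card.empty not_less of_nat_0)
  have finL: "finite ?L" using fin by simp
  have "\<epsilon> * (real (card ?L) * real (card B)) \<le> real (card (G \<inter> ?L \<times> B))"
    using \<epsilon> by (intro regular_pair_edges[OF assms(1,2) _ _ L]) (auto simp: mult_left_le_one_le)
  also have "G \<inter> ?L \<times> B = (SIGMA x:?L. G `` {x} \<inter> B)" by auto
  also have "real (card \<dots>) = (\<Sum>x\<in>?L. real (card (G `` {x} \<inter> B)))"
    using fin finL by (subst card_SigmaI) auto
  also have "\<dots> < (\<Sum>x\<in>?L. \<epsilon> * real (card B))"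
    using finL Lne by (intro sum_strict_mono) auto
  finally show False by (simp add: algebra_simps)
qed

text \<open>All but \<open>2 * \<epsilon> * card A\<close> vertices of \<open>A\<close> have
  neighbourhoods in \<open>B\<close> and \<open>C\<close> large enough for the regularity of
  \<open>B\<close> and \<open>C\<close> to apply. An \<open>\<epsilon>\<close>-fraction of the pairs
  between them then closes a triangle.\<close>

lemma triangle_counting:
  assumes AB: "regular_pair \<epsilon> G A B" "2 * \<epsilon> \<le> edge_density G A B"
    and AC: "regular_pair \<epsilon> G A C" "2 * \<epsilon> \<le> edge_density G A C"
    and BC: "regular_pair \<epsilon> G B C" "2 * \<epsilon> \<le> edge_density G B C"
    and fin: "finite A" "finite B" "finite C" and ne: "A \<noteq> {}" "B \<noteq> {}" "C \<noteq> {}"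
    and \<epsilon>: "0 < \<epsilon>" "\<epsilon> \<le> 1"
  shows "(1 - 2 * \<epsilon>) * \<epsilon> ^ 3 * (real (card A) * real (card B) * real (card C))
       \<le> real (card (triangles G \<inter> A \<times> B \<times> C))"
proof -
  let ?L = "\<lambda>D. {x \<in> A. real (card (G `` {x} \<inter> D)) < \<epsilon> * real (card D)}"
  define A0 where "A0 = A - (?L B \<union> ?L C)"
  have finA0: "finite A0" using fin by (simp add: A0_def)
  have "card (?L B \<union> ?L C) \<le> card (?L B) + card (?L C)" by (rule card_Un_le)
  moreover have "card A0 = card A - card (?L B \<union> ?L C)"
    unfolding A0_def using fin by (intro card_Diff_subset) auto
  ultimately have "real (card A0) \<ge> real (card A) - (real (card (?L B)) + real (card (?L C)))" by linarith
  then have cA0: "(1 - 2 * \<epsilon>) * real (card A) \<le> real (card A0)"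
    using card_low_degree_less[OF AB fin(1,2) ne(1,2) \<epsilon>] card_low_degree_less[OF AC fin(1,3) ne(1,3) \<epsilon>]
    by (simp add: algebra_simps)
  have deg: "\<epsilon> ^ 3 * (real (card B) * real (card C)) \<le> real (card (G \<inter> (G `` {x} \<inter> B) \<times> (G `` {x} \<inter> C)))"
    if "x \<in> A0" for x
  proof -
    have 1: "\<epsilon> * real (card B) \<le> real (card (G `` {x} \<inter> B))" "\<epsilon> * real (card C) \<le> real (card (G `` {x} \<inter> C))"
      using that by (auto simp: A0_def)
    have "\<epsilon> * ((\<epsilon> * real (card B)) * (\<epsilon> * real (card C)))
        \<le> \<epsilon> * (real (card (G `` {x} \<inter> B)) * real (card (G `` {x} \<inter> C)))"
      using 1 \<epsilon> by (intro mult_left_mono mult_mono) auto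
    also have "\<dots> \<le> real (card (G \<inter> (G `` {x} \<inter> B) \<times> (G `` {x} \<inter> C)))"
      using 1 by (intro regular_pair_edges[OF BC]) auto
    finally show ?thesis by (simp only: power3_eq_cube ac_simps)
  qed
  have "(1 - 2 * \<epsilon>) * \<epsilon> ^ 3 * (real (card A) * real (card B) * real (card C))
      = ((1 - 2 * \<epsilon>) * real (card A)) * (\<epsilon> ^ 3 * (real (card B) * real (card C)))" by simp
  also have "\<dots> \<le> real (card A0) * (\<epsilon> ^ 3 * (real (card B) * real (card C)))"
    using cA0 \<epsilon> by (intro mult_right_mono) auto
  also have "\<dots> = (\<Sum>x\<in>A0. \<epsilon> ^ 3 * (real (card B) * real (card C)))" by simp
  also have "\<dots> \<le> (\<Sum>x\<in>A0. real (card (G \<inter> (G `` {x} \<inter> B) \<times> (G `` {x} \<inter> C))))"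
    by (intro sum_mono deg)
  also have "\<dots> = real (card (SIGMA x:A0. G \<inter> (G `` {x} \<inter> B) \<times> (G `` {x} \<inter> C)))"
    using finA0 fin by (subst card_SigmaI) auto
  also have "\<dots> \<le> real (card (triangles G \<inter> A \<times> B \<times> C))"
    using fin by (intro of_nat_mono card_mono) (auto simp: triangles_def A0_def)
  finally show ?thesis .
qed

lemma card_small_cells_le:
  assumes "finite V" "finite \<W>" "0 \<le> t"
  shows "real (card {x \<in> V. real (card (cell V (members \<W>) x)) < t}) \<le> 2 ^ card \<W> * t"
proof -
  let ?S = "{x \<in> V. real (card (cell V (members \<W>) x)) < t}" and ?k = "members \<W>"
  obtain P where P: "P \<subseteq> ?S" "inj_on ?k P" "?k ` ?S = ?k ` P"
    using subset_image_inj[of "?k ` ?S" ?k ?S] by auto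
  have finP: "finite P" using P(1) assms(1) by (auto intro: finite_subset)
  have "card P = card (?k ` P)" using P(2) by (simp add: card_image)
  also have "\<dots> \<le> card (Pow \<W>)"
    using assms(2) by (intro card_mono) (auto simp: members_def)
  finally have cardP: "card P \<le> 2 ^ card \<W>" using assms(2) by (simp add: card_Pow)
  have "?S \<subseteq> (\<Union>p\<in>P. cell V ?k p)"
  proof
    fix q assume q: "q \<in> ?S"
    then have "?k q \<in> ?k ` P" using P(3) by blast
    then obtain p where "p \<in> P" "?k q = ?k p" by blast
    then show "q \<in> (\<Union>p\<in>P. cell V ?k p)" using q by (auto simp: cell_def)
  qed
  then have "card ?S \<le> card (\<Union>p\<in>P. cell V ?k p)"
    using finP assms(1) by (intro card_mono) (auto intro: finite_cell)
  also have "\<dots> \<le> (\<Sum>p\<in>P. card (cell V ?k p))"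
    by (rule card_UN_le[OF finP])
  finally have "real (card ?S) \<le> (\<Sum>p\<in>P. real (card (cell V ?k p)))"
    unfolding of_nat_sum[symmetric] by (rule of_nat_mono)
  also have "\<dots> \<le> (\<Sum>p\<in>P. t)"
    using P(1) by (intro sum_mono) (auto intro: less_imp_le)
  also have "\<dots> \<le> 2 ^ card \<W> * t"
    using cardP assms(3) by (simp add: mult_right_mono numeral_power_le_of_nat_cancel_iff)
  finally show ?thesis .
qed

text \<open>Whether a pair is sparse depends only on its label. The indicator of \<open>G\<close>
  may thus be replaced by its average, which is below \<open>t\<close> wherever it is
  counted.\<close>

lemma card_sparse_edges_le:
  assumes V: "finite V" and G: "G \<subseteq> V \<times> V" and "0 \<le> t"
  shows "real (card {p \<in> G. edge_density G (cell V (members \<W>) (fst p)) (cell V (members \<W>) (snd p)) < t})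
       \<le> t * (real (card V))\<^sup>2"
proof -
  let ?a = "avg (V \<times> V) (members2 \<W>) (indicator G)"
  let ?S = "{p \<in> G. edge_density G (cell V (members \<W>) (fst p)) (cell V (members \<W>) (snd p)) < t}"
  have a: "?a p = edge_density G (cell V (members \<W>) (fst p)) (cell V (members \<W>) (snd p))" for p
    using avg_members2[OF V, of \<W> G "fst p" "snd p"] by simp
  have "real (card ?S) = (\<Sum>p\<in>?S. 1)" by simp
  also have "\<dots> = (\<Sum>p\<in>V \<times> V. indicator G p * of_bool (?a p < t))"
    using G V by (intro sum.mono_neutral_cong_left) (auto simp: a indicator_def)
  also have "\<dots> = (\<Sum>p\<in>V \<times> V. ?a p * of_bool (?a p < t))"
  proof (rule sum_avg_mult[symmetric])
    fix p q :: "'a \<times> 'a" assume "members2 \<W> p = members2 \<W> q"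
    then show "(of_bool (?a p < t) :: real) = of_bool (?a q < t)"
      using avg_eq[of "members2 \<W>" p q "V \<times> V" "indicator G"] by simp
  qed (use V in simp)
  also have "\<dots> \<le> (\<Sum>p\<in>V \<times> V. t)"
    using \<open>0 \<le> t\<close> by (intro sum_mono) (auto simp: of_bool_def)
  also have "\<dots> = t * (real (card V))\<^sup>2"
    by (simp add: card_cartesian_product power2_eq_square)
  finally show ?thesis .
qed

text \<open>An edge outside \<open>R\<close> joins two large cells that form a dense regular pair. A
  single surviving triangle therefore produces, by counting, more triangles than \<open>G\<close>
  has.\<close>

theorem triangle_removal:
  assumes "\<epsilon> > 0"
  shows "\<exists>\<delta>>0. \<forall>(V :: 'a set) G. finite V \<longrightarrow> G \<subseteq> V \<times> V \<longrightarrow>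
     real (card (triangles G)) \<le> \<delta> * real (card V) ^ 3 \<longrightarrow>
     (\<exists>R\<subseteq>G. real (card R) \<le> \<epsilon> * (real (card V))\<^sup>2 \<and> triangles (G - R) = {})"
proof -
  \<comment> \<open>The 5 adds the shares of removed edges: 1 for irregular pairs, 2 for sparse
    pairs, and 1 for small cells at either endpoint. The bound 1/4 ensures
    \<open>1 - 2 * \<eta> \<ge> 1 / 2\<close>.\<close>
  define \<eta> where "\<eta> = min (\<epsilon> / 5) (1 / 4)"
  have \<eta>: "0 < \<eta>" "5 * \<eta> \<le> \<epsilon>" "\<eta> \<le> 1 / 4" using assms by (auto simp: \<eta>_def)
  obtain M where M: "\<And>(V :: 'a set) G. finite V \<Longrightarrow> \<exists>\<W>. finite \<W> \<and> card \<W> \<le> M \<and>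
    real (card (irregular \<eta> V G \<W>)) \<le> \<eta> * (real (card V))\<^sup>2"
    using regularity_lemma[OF \<eta>(1), where ?'a = 'a] by blast
  \<comment> \<open>This is half of what triangle counting gives for three cells of size
    \<open>t = \<eta> * n / 2 ^ M\<close>; the spare factor 2 yields a strict contradiction.\<close>
  define \<delta> where "\<delta> = \<eta> ^ 3 * (\<eta> / 2 ^ M) ^ 3 / 4"
  have "\<delta> > 0" using \<eta> by (simp add: \<delta>_def)
  moreover have "\<exists>R\<subseteq>G. real (card R) \<le> \<epsilon> * (real (card V))\<^sup>2 \<and> triangles (G - R) = {}"
    if V: "finite V" and G: "G \<subseteq> V \<times> V" and T: "real (card (triangles G)) \<le> \<delta> * real (card V) ^ 3"
    for V :: "'a set" and G
  proof -
    obtain \<W> where W: "finite \<W>" "card \<W> \<le> M"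
      and irr: "real (card (irregular \<eta> V G \<W>)) \<le> \<eta> * (real (card V))\<^sup>2" using M[OF V, of G] by auto
    let ?c = "cell V (members \<W>)" and ?n = "real (card V)"
    define t where "t = \<eta> * ?n / 2 ^ M"
    have t: "0 \<le> t" using \<eta> by (simp add: t_def)
    define S where "S = {x \<in> V. real (card (?c x)) < t}"
    define D where "D = {p \<in> G. edge_density G (?c (fst p)) (?c (snd p)) < 2 * \<eta>}"
    define R where "R = G \<inter> (irregular \<eta> V G \<W> \<union> D \<union> S \<times> V \<union> V \<times> S)"
    have finS: "finite S" using V by (simp add: S_def)
    have finG: "finite G" using G V finite_subset by blast
    have "real (card S) \<le> 2 ^ card \<W> * t"
      unfolding S_def by (rule card_small_cells_le[OF V W(1) t])
    also have "\<dots> \<le> 2 ^ M * t" using W(2) t by (intro mult_right_mono power_increasing) auto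
    finally have cS: "real (card S) \<le> \<eta> * ?n" by (simp add: t_def)
    have cD: "real (card D) \<le> 2 * \<eta> * ?n\<^sup>2"
      unfolding D_def using \<eta> by (intro card_sparse_edges_le[OF V G]) auto
    have "card R \<le> card (irregular \<eta> V G \<W> \<union> D \<union> S \<times> V \<union> V \<times> S)"
      unfolding R_def using V finS finG by (intro card_mono) (auto simp: irregular_def D_def)
    also have "\<dots> \<le> card (irregular \<eta> V G \<W>) + card D + card (S \<times> V) + card (V \<times> S)"
      by (intro order.trans[OF card_Un_le] add_mono order_refl)
    finally have "real (card R) \<le> real (card (irregular \<eta> V G \<W>)) + real (card D)
        + real (card S) * ?n + ?n * real (card S)"
      unfolding card_cartesian_product of_nat_add[symmetric] of_nat_mult[symmetric] by (rule of_nat_mono)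
    also have "\<dots> \<le> \<eta> * ?n\<^sup>2 + 2 * \<eta> * ?n\<^sup>2 + (\<eta> * ?n) * ?n + ?n * (\<eta> * ?n)"
      using irr cD cS by (intro add_mono mult_right_mono mult_left_mono) auto
    also have "\<dots> = (5 * \<eta>) * ?n\<^sup>2" by (simp add: power2_eq_square)
    also have "\<dots> \<le> \<epsilon> * ?n\<^sup>2" using \<eta> by (intro mult_right_mono) auto
    finally have cR: "real (card R) \<le> \<epsilon> * ?n\<^sup>2" .
    have "triangles (G - R) = {}"
    proof (rule ccontr)
      assume "triangles (G - R) \<noteq> {}"
      then obtain x y z where xyz: "(x, y) \<in> G - R" "(y, z) \<in> G - R" "(x, z) \<in> G - R"
        by (auto simp: triangles_def)
      have good: "x \<in> V \<and> y \<in> V \<and> t \<le> real (card (?c x)) \<and> t \<le> real (card (?c y)) \<and>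
          regular_pair \<eta> G (?c x) (?c y) \<and> 2 * \<eta> \<le> edge_density G (?c x) (?c y)"
        if "(x, y) \<in> G - R" for x y
        using that G by (auto simp: R_def S_def D_def irregular_def)
      note g = good[OF xyz(1)] good[OF xyz(2)] good[OF xyz(3)]
      have V0: "?n > 0" using g V by (auto simp: card_gt_0_iff)
      have ne: "?c x \<noteq> {}" "?c y \<noteq> {}" "?c z \<noteq> {}"
        using g cell_self[of _ V "members \<W>"] by blast+
      have "2 * \<delta> * ?n ^ 3 = 1 / 2 * \<eta> ^ 3 * (t * t * t)"
        by (simp add: \<delta>_def t_def power3_eq_cube algebra_simps)
      also have "\<dots> \<le> (1 - 2 * \<eta>) * \<eta> ^ 3 * (real (card (?c x)) * real (card (?c y)) * real (card (?c z)))"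
        using g t \<eta> by (intro mult_mono) auto
      also have "\<dots> \<le> real (card (triangles G \<inter> ?c x \<times> ?c y \<times> ?c z))"
        using g \<eta> ne V by (intro triangle_counting) (auto intro: finite_cell)
      also have "\<dots> \<le> real (card (triangles G))"
      proof (intro of_nat_mono card_mono)
        show "finite (triangles G)"
          by (rule finite_subset[of _ "V \<times> V \<times> V"]) (use V G in \<open>auto simp: triangles_def\<close>)
      qed auto
      also note T
      finally show False using \<open>\<delta> > 0\<close> V0 by (simp add: mult_le_cancel_right)
    qed
    then show ?thesis using cR by (intro exI[of _ R]) (auto simp: R_def)
  qed
  ultimately show ?thesis by blast
qed

subsection \<open>The removal lemma for linear equations\<close>

definition solutions :: "int ^ 3 \<Rightarrow> nat set \<Rightarrow> (nat \<times> nat \<times> nat) set" where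
  "solutions a A = {(x, y, z). x \<in> A \<and> y \<in> A \<and> z \<in> A \<and>
     a $ 1 * int x + a $ 2 * int y + a $ 3 * int z = 0}"

lemma finite_solutions: "finite A \<Longrightarrow> finite (solutions a A)"
  by (rule finite_subset[of _ "A \<times> A \<times> A"]) (auto simp: solutions_def)

theorem solution_removal:
  fixes a :: "int ^ 3"
  assumes a: "\<forall>i. a $ i \<noteq> 0" and \<epsilon>: "\<epsilon> > 0"
  shows "\<exists>\<delta>>0. \<forall>n F. F \<subseteq> {1..n} \<longrightarrow> real (card (solutions a F)) \<le> \<delta> * (real n)\<^sup>2 \<longrightarrow>
    (\<exists>R\<subseteq>F. real (card R) \<le> \<epsilon> * real n \<and> solutions a (F - R) = {})"
proof -
  define K where "K = \<bar>a $ 1\<bar> + \<bar>a $ 2\<bar> + \<bar>a $ 3\<bar>"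
  have a0: "a $ 1 \<noteq> 0" "a $ 2 \<noteq> 0" "a $ 3 \<noteq> 0" using a by auto
  then have K: "K \<ge> 1" by (simp add: K_def)
  \<comment> \<open>Here 432 = 3 * 12^2: the 3 comes from the threshold n/3 in \<open>R\<close>, the
    12 from the bound of 12 * K * n on the number of vertices.\<close>
  define \<epsilon>' where "\<epsilon>' = \<epsilon> / (432 * (real_of_int K)\<^sup>2)"
  have "\<epsilon>' > 0" using \<epsilon> K by (simp add: \<epsilon>'_def)
  from triangle_removal[OF this, where ?'a = "nat \<times> int"]
  obtain \<delta> where \<delta>: "\<delta> > 0" and removal: "\<And>(V :: (nat \<times> int) set) G. finite V \<Longrightarrow> G \<subseteq> V \<times> V \<Longrightarrow>
     real (card (triangles G)) \<le> \<delta> * real (card V) ^ 3 \<Longrightarrow>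
     (\<exists>R\<subseteq>G. real (card R) \<le> \<epsilon>' * (real (card V))\<^sup>2 \<and> triangles (G - R) = {})"
    by blast
  have "\<exists>R\<subseteq>F. real (card R) \<le> \<epsilon> * real n \<and> solutions a (F - R) = {}"
    if F: "F \<subseteq> {1..n}" and few: "real (card (solutions a F)) \<le> \<delta> * (real n)\<^sup>2" for n F
  proof (cases "n = 0")
    case True
    then show ?thesis using F by (auto simp: solutions_def)
  next
    case False
    have finF: "finite F" using F finite_subset by blast
    define m where "m = K * int n"
    have m: "m = \<bar>a $ 1\<bar> * int n + \<bar>a $ 2\<bar> * int n + \<bar>a $ 3\<bar> * int n"
      by (simp add: m_def K_def algebra_simps)
    have bnd: "\<bar>a $ i * int f\<bar> \<le> \<bar>a $ i\<bar> * int n" if "f \<in> F" for i f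
      using that F unfolding abs_mult by (intro mult_left_mono) auto
    have n_le: "int n \<le> \<bar>a $ i\<bar> * int n" for i
      using a mult_right_mono[of 1 "\<bar>a $ i\<bar>" "int n"] by (simp add: int_one_le_iff_zero_less)
    have m_pos: "m \<ge> 1" using n_le[of 1] n_le[of 2] n_le[of 3] False m by linarith
    \<comment> \<open>The triangles with start in \<open>{0..<int n}\<close> fit into this interval:
      every partial sum of a solution is at most \<open>m\<close> in absolute value, and
      \<open>n\<close> is at most \<open>m\<close>.\<close>
    define V where "V = {0, 1, 2 :: nat} \<times> {- m..2 * m}"
    have finV: "finite V" by (simp add: V_def)
    have cardI: "real (card {- m..2 * m}) = real_of_int (3 * m + 1)" using m_pos by simp
    have cardV: "real (card V) = 3 * real_of_int (3 * m + 1)"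
      unfolding V_def card_cartesian_product of_nat_mult cardI by simp
    have mr: "real_of_int m = real_of_int K * real n" by (simp add: m_def)
    have m1: "1 \<le> real_of_int m" using m_pos by simp
    have V_le: "real (card V) \<le> 12 * (real_of_int K * real n)"
      using m1 unfolding cardV mr[symmetric] by simp
    have V_ge: "4 * real_of_int m \<le> real (card V)"
      using m1 unfolding cardV by simp
    \<comment> \<open>A solution \<open>(f1, f2, f3)\<close> gives one triangle for each start \<open>x\<close>; these triangles are edge-disjoint,
      as the label \<open>f\<close> of an edge can be read off from its endpoints.\<close>
    define e1 where "e1 x f = ((0 :: nat, x), (1 :: nat, x + a $ 1 * int f))" for x f
    define e2 where "e2 x f = ((1 :: nat, x), (2 :: nat, x + a $ 2 * int f))" for x f
    define e3 where "e3 x f = ((0 :: nat, x), (2 :: nat, x - a $ 3 * int f))" for x f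
    note e_defs = e1_def e2_def e3_def
    define G where "G = {p \<in> V \<times> V. \<exists>x. \<exists>f\<in>F. p = e1 x f \<or> p = e2 x f \<or> p = e3 x f}"
    have "triangles G \<subseteq> (\<lambda>(x, f1, f2, f3). ((0, x), (1, x + a $ 1 * int f1), (2, x - a $ 3 * int f3)))
        ` ({- m..2 * m} \<times> solutions a F)"
    proof
      fix t assume "t \<in> triangles G"
      then obtain p q r where t: "t = (p, q, r)" "(p, q) \<in> G" "(q, r) \<in> G" "(p, r) \<in> G"
        by (auto simp: triangles_def)
      obtain x f1 where f1: "f1 \<in> F" and pq: "(p, q) = e1 x f1 \<or> (p, q) = e2 x f1 \<or> (p, q) = e3 x f1"
        using t(2) unfolding G_def by blast
      obtain y f2 where f2: "f2 \<in> F" and qr: "(q, r) = e1 y f2 \<or> (q, r) = e2 y f2 \<or> (q, r) = e3 y f2"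
        using t(3) unfolding G_def by blast
      have pq: "(p, q) = e1 x f1" and qr: "(q, r) = e2 y f2"
        using pq qr by (elim disjE; simp add: e_defs)+
      then have fst_pq: "fst p = 0" "fst q = 1" and fst_r: "fst r = 2" by (simp_all add: e1_def e2_def)
      have x: "x \<in> {- m..2 * m}"
        using t(2) pq by (simp add: G_def V_def e1_def)
      obtain w f3 where f3: "f3 \<in> F" and pr: "(p, r) = e1 w f3 \<or> (p, r) = e2 w f3 \<or> (p, r) = e3 w f3"
        using t(4) unfolding G_def by blast
      have pr: "(p, r) = e3 w f3" using pr fst_pq fst_r by (elim disjE) (simp_all add: e_defs)
      \<comment> \<open>The two routes to the third layer agree precisely when \<open>f1\<close>,
        \<open>f2\<close>, \<open>f3\<close> satisfy the equation; the sign in \<open>e3\<close> is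
        chosen for this.\<close>
      have "(f1, f2, f3) \<in> solutions a F"
        using f1 f2 f3 pq qr pr by (simp add: solutions_def e_defs)
      moreover have "t = ((0, x), (1, x + a $ 1 * int f1), (2, x - a $ 3 * int f3))"
        using t(1) pq qr pr by (simp add: e_defs)
      ultimately show "t \<in> (\<lambda>(x, f1, f2, f3). ((0, x), (1, x + a $ 1 * int f1), (2, x - a $ 3 * int f3)))
        ` ({- m..2 * m} \<times> solutions a F)"
        using x by (intro image_eqI[of _ _ "(x, f1, f2, f3)"]) auto
    qed
    then have "card (triangles G) \<le> card ({- m..2 * m} \<times> solutions a F)"
      using finite_solutions[OF finF] by (intro surj_card_le) auto
    then have "real (card (triangles G)) \<le> real_of_int (3 * m + 1) * real (card (solutions a F))"
      unfolding card_cartesian_product cardI[symmetric] of_nat_mult[symmetric] by (rule of_nat_mono)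
    also have "\<dots> \<le> (4 * real_of_int m) * (\<delta> * (real_of_int m)\<^sup>2)"
    proof (rule mult_mono)
      have "int n \<le> m" using n_le[of 1] n_le[of 2] n_le[of 3] m by linarith
      then have "real n \<le> real_of_int m" by (metis of_int_le_iff of_int_of_nat_eq)
      then have "(real n)\<^sup>2 \<le> (real_of_int m)\<^sup>2" by (rule power_mono) simp
      then show "real (card (solutions a F)) \<le> \<delta> * (real_of_int m)\<^sup>2"
        using few \<delta> by (meson mult_left_mono less_imp_le order_trans)
    qed (use m_pos in auto)
    also have "\<dots> \<le> \<delta> * (4 * real_of_int m) ^ 3"
      using \<delta> m_pos by (simp add: power2_eq_square power3_eq_cube)
    also have "\<dots> \<le> \<delta> * real (card V) ^ 3"
      using \<delta> V_ge m_pos by (intro mult_left_mono power_mono) auto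
    finally have "real (card (triangles G)) \<le> \<delta> * real (card V) ^ 3" .
    moreover have "G \<subseteq> V \<times> V" by (auto simp: G_def)
    ultimately obtain E where E: "E \<subseteq> G" "real (card E) \<le> \<epsilon>' * (real (card V))\<^sup>2"
      and noT: "triangles (G - E) = {}" using removal[OF finV] by blast
    have finE: "finite E"
      using E(1) finV by (intro finite_subset[of E "V \<times> V"]) (auto simp: G_def)
    define c where "c f = {p \<in> E. \<exists>x. p = e1 x f \<or> p = e2 x f \<or> p = e3 x f}" for f
    have finc: "finite (c f)" for f using finE by (simp add: c_def)
    \<comment> \<open>An element is deleted if it labels at least n/3 of the removed edges. As an
      edge has only one label, there are at most 3 * card E / n such elements.\<close>
    define R where "R = {f \<in> F. n \<le> 3 * card (c f)}"
    have finR: "finite R" using finF by (simp add: R_def)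
    have "n * card R = (\<Sum>f\<in>R. n)" by simp
    also have "\<dots> \<le> (\<Sum>f\<in>R. 3 * card (c f))" by (intro sum_mono) (auto simp: R_def)
    also have "\<dots> = 3 * card (\<Union>f\<in>R. c f)"
    proof -
      have "c f \<inter> c g = {}" if "f \<noteq> g" for f g
        using that a0 by (auto simp: c_def e_defs)
      then show ?thesis
        using finR finc by (subst card_UN_disjoint) (auto simp: sum_distrib_left)
    qed
    also have "\<dots> \<le> 3 * card E"
      using finE by (intro mult_le_mono2 card_mono) (auto simp: c_def)
    finally have "real n * real (card R) \<le> 3 * real (card E)"
      by (metis of_nat_le_iff of_nat_mult of_nat_numeral)
    also have "\<dots> \<le> 3 * (\<epsilon>' * (12 * (real_of_int K * real n))\<^sup>2)"
    proof -
      have "(real (card V))\<^sup>2 \<le> (12 * (real_of_int K * real n))\<^sup>2"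
        using V_le by (rule power_mono) simp
      then have "\<epsilon>' * (real (card V))\<^sup>2 \<le> \<epsilon>' * (12 * (real_of_int K * real n))\<^sup>2"
        using \<open>\<epsilon>' > 0\<close> by simp
      then show ?thesis using E(2) by linarith
    qed
    also have "\<dots> = real n * (\<epsilon> * real n)"
      using K by (simp add: \<epsilon>'_def power_mult_distrib power2_eq_square)
    finally have cR: "real (card R) \<le> \<epsilon> * real n" using False by simp
    have "solutions a (F - R) = {}"
    proof (rule ccontr)
      assume "solutions a (F - R) \<noteq> {}"
      then obtain f1 f2 f3 where f: "f1 \<in> F - R" "f2 \<in> F - R" "f3 \<in> F - R"
        and eq: "a $ 1 * int f1 + a $ 2 * int f2 + a $ 3 * int f3 = 0"
        by (auto simp: solutions_def)
      let ?X1 = "{x \<in> {0..<int n}. e1 x f1 \<in> E}"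
      let ?X2 = "{x \<in> {0..<int n}. e2 (x + a $ 1 * int f1) f2 \<in> E}"
      let ?X3 = "{x \<in> {0..<int n}. e3 x f3 \<in> E}"
      \<comment> \<open>Each of the \<open>n\<close> triangles of a surviving solution has lost an
        edge, so one of its three labels accounts for at least n/3 removed edges and would be in
        \<open>R\<close>.\<close>
      have "{0..<int n} \<subseteq> ?X1 \<union> ?X2 \<union> ?X3"
      proof
        fix x assume x: "x \<in> {0..<int n}"
        let ?y = "x + a $ 1 * int f1" and ?z = "x - a $ 3 * int f3"
        have z: "?z = ?y + a $ 2 * int f2" using eq by linarith
        define A where "A i = \<bar>a $ i\<bar> * int n" for i
        have "a $ 1 * int f1 \<le> A 1" "- A 1 \<le> a $ 1 * int f1"
          "a $ 3 * int f3 \<le> A 3" "- A 3 \<le> a $ 3 * int f3"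
          using bnd[of f1 1] bnd[of f3 3] f unfolding A_def abs_le_iff by auto
        moreover have "m = A 1 + A 2 + A 3" "int n \<le> A 1" "int n \<le> A 2" "int n \<le> A 3"
          using n_le unfolding A_def m by auto
        moreover have "0 \<le> x" "x < int n" using x by auto
        ultimately have "x \<in> {- m..2 * m}" "?y \<in> {- m..2 * m}" "?z \<in> {- m..2 * m}"
          unfolding atLeastAtMost_iff by linarith+
        then have inV: "(0, x) \<in> V" "(1, ?y) \<in> V" "(2, ?z) \<in> V" by (auto simp: V_def)
        have "e1 x f1 \<in> G" "e2 ?y f2 \<in> G" "e3 x f3 \<in> G"
        proof -
          have "e1 x f1 \<in> V \<times> V" "e2 ?y f2 \<in> V \<times> V" "e3 x f3 \<in> V \<times> V"
            unfolding e_defs z[symmetric] using inV by auto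
          then show "e1 x f1 \<in> G" "e2 ?y f2 \<in> G" "e3 x f3 \<in> G"
            using f unfolding G_def by blast+
        qed
        moreover have "((0, x), (1, ?y), (2, ?z)) \<notin> triangles (G - E)" using noT by simp
        ultimately have "e1 x f1 \<in> E \<or> e2 ?y f2 \<in> E \<or> e3 x f3 \<in> E"
          unfolding triangles_def e_defs z[symmetric] by auto
        then show "x \<in> ?X1 \<union> ?X2 \<union> ?X3" using x by auto
      qed
      moreover have "finite (?X1 \<union> ?X2 \<union> ?X3)"
        by (rule finite_subset[of _ "{0..<int n}"]) auto
      ultimately have "card {0..<int n} \<le> card (?X1 \<union> ?X2 \<union> ?X3)" by (rule card_mono[rotated])
      also have "\<dots> \<le> card ?X1 + card ?X2 + card ?X3"
        by (intro order.trans[OF card_Un_le] add_mono order_refl)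
      also have "\<dots> \<le> card (c f1) + card (c f2) + card (c f3)"
      proof (intro add_mono)
        show "card ?X1 \<le> card (c f1)"
          by (rule card_inj_on_le[of "\<lambda>x. e1 x f1"]) (use finc in \<open>auto simp: c_def e_defs inj_on_def\<close>)
        show "card ?X2 \<le> card (c f2)"
          by (rule card_inj_on_le[of "\<lambda>x. e2 (x + a $ 1 * int f1) f2"])
             (use finc in \<open>auto simp: c_def e_defs inj_on_def\<close>)
        show "card ?X3 \<le> card (c f3)"
          by (rule card_inj_on_le[of "\<lambda>x. e3 x f3"]) (use finc in \<open>auto simp: c_def e_defs inj_on_def\<close>)
      qed
      finally have "n \<le> card (c f1) + card (c f2) + card (c f3)" by simp
      moreover have "3 * card (c f1) < n" "3 * card (c f2) < n" "3 * card (c f3) < n"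
        using f by (auto simp: R_def)
      ultimately show False by linarith
    qed
    then show ?thesis using cR by (intro exI[of _ R]) (auto simp: R_def)
  qed
  then show ?thesis using \<delta> by blast
qed

subsection \<open>Containers\<close>

definition nontrivial :: "int ^ 3 \<Rightarrow> nat \<Rightarrow> nat \<Rightarrow> nat \<Rightarrow> bool" where
  "nontrivial a x y z \<longleftrightarrow> a $ 1 * int x + a $ 2 * int y + a $ 3 * int z = 0 \<and>
     \<not> (a $ 1 + a $ 2 + a $ 3 = 0 \<and> x = y \<and> y = z)"

text \<open>No coefficient is 0, so a class of a partition witnessing triviality is never a
  singleton, and two classes of size at least 2 do not fit into three indices. Only the partition
  with one class remains.\<close>

lemma eq_free_iff:
  assumes a: "\<forall>i. a $ i \<noteq> 0"
  shows "eq_free a A \<longleftrightarrow> (\<forall>x\<in>A. \<forall>y\<in>A. \<forall>z\<in>A. \<not> nontrivial a x y z)"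
proof -
  have sol: "is_solution a v \<longleftrightarrow> a $ 1 * int (v $ 1) + a $ 2 * int (v $ 2) + a $ 3 * int (v $ 3) = 0" for v
    by (simp add: is_solution_def sum_3)
  have triv: "trivial_solution a v \<longleftrightarrow> is_solution a v \<and> a $ 1 + a $ 2 + a $ 3 = 0 \<and> v $ 1 = v $ 2 \<and> v $ 2 = v $ 3" for v
  proof
    assume "is_solution a v \<and> a $ 1 + a $ 2 + a $ 3 = 0 \<and> v $ 1 = v $ 2 \<and> v $ 2 = v $ 3"
    then have v: "is_solution a v" "a $ 1 + a $ 2 + a $ 3 = 0" "v $ 1 = v $ 2" "v $ 2 = v $ 3" by auto
    have "\<forall>i j. v $ i = v $ j" using v(3,4) by (simp add: forall_3)
    then show "trivial_solution a v"
      unfolding trivial_solution_def using v(1,2)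
      by (intro conjI exI[of _ "{UNIV}"]) (auto simp: partition_on_def disjoint_def sum_3)
  next
    assume "trivial_solution a v"
    then obtain \<P> where s: "is_solution a v" and P: "partition_on UNIV \<P>"
      and cls: "\<And>P. P \<in> \<P> \<Longrightarrow> (\<forall>i\<in>P. \<forall>j\<in>P. v $ i = v $ j) \<and> (\<Sum>i\<in>P. a $ i) = 0"
      unfolding trivial_solution_def by blast
    have ex: "\<exists>P\<in>\<P>. i \<in> P" for i using partition_onD1[OF P] by blast
    have not_single: "card P \<noteq> 1" if "P \<in> \<P>" for P
    proof
      assume "card P = 1"
      then obtain i where "P = {i}" by (rule card_1_singletonE)
      then show False using cls[OF that] a by simp
    qed
    obtain P where P1: "P \<in> \<P>" "1 \<in> P" using ex by blast
    have "P = UNIV"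
    proof (rule ccontr)
      assume "P \<noteq> UNIV"
      then obtain i where "i \<notin> P" by blast
      moreover obtain Q where Q: "Q \<in> \<P>" "i \<in> Q" using ex by blast
      ultimately have "P \<noteq> Q" by blast
      then have "P \<inter> Q = {}"
        using disjointD[OF partition_onD2[OF P] P1(1) Q(1)] by simp
      then have "card P + card Q = card (P \<union> Q)" by (simp add: card_Un_disjoint)
      also have "\<dots> \<le> 3" using card_mono[of "UNIV :: 3 set" "P \<union> Q"] by simp
      finally have "card P + card Q \<le> 3" .
      moreover have "card P \<noteq> 0" "card Q \<noteq> 0" using P1 Q by auto
      ultimately show False using not_single[OF P1(1)] not_single[OF Q(1)] by linarith
    qed
    then have "UNIV \<in> \<P>" using P1(1) by simp
    from cls[OF this] show "is_solution a v \<and> a $ 1 + a $ 2 + a $ 3 = 0 \<and> v $ 1 = v $ 2 \<and> v $ 2 = v $ 3"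
      using s by (simp add: sum_3)
  qed
  show ?thesis
  proof
    assume free: "eq_free a A"
    show "\<forall>x\<in>A. \<forall>y\<in>A. \<forall>z\<in>A. \<not> nontrivial a x y z"
    proof (intro ballI notI)
      fix x y z assume A: "x \<in> A" "y \<in> A" "z \<in> A" and nt: "nontrivial a x y z"
      have "\<forall>i. (vector [x, y, z] :: nat ^ 3) $ i \<in> A" using A by (simp add: forall_3)
      then show False
        using free nt unfolding eq_free_def triv sol nontrivial_def
        by (metis vector_3)
    qed
  next
    assume "\<forall>x\<in>A. \<forall>y\<in>A. \<forall>z\<in>A. \<not> nontrivial a x y z"
    then show "eq_free a A"
      unfolding eq_free_def triv sol nontrivial_def by blast
  qed
qed

definition nontrivial_solutions :: "int ^ 3 \<Rightarrow> nat set \<Rightarrow> (nat \<times> nat \<times> nat) set" where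
  "nontrivial_solutions a A = {(x, y, z). x \<in> A \<and> y \<in> A \<and> z \<in> A \<and> nontrivial a x y z}"

lemma nontrivial_unique:
  assumes "\<forall>i. a $ i \<noteq> 0"
  shows "nontrivial a x y z \<Longrightarrow> nontrivial a x' y z \<Longrightarrow> x = x'"
    and "nontrivial a x y z \<Longrightarrow> nontrivial a x y' z \<Longrightarrow> y = y'"
    and "nontrivial a x y z \<Longrightarrow> nontrivial a x y z' \<Longrightarrow> z = z'"
proof -
  assume "nontrivial a x y z" "nontrivial a x' y z"
  then have "a $ 1 * int x = a $ 1 * int x'" unfolding nontrivial_def by linarith
  then show "x = x'" using assms by simp
next
  assume "nontrivial a x y z" "nontrivial a x y' z"
  then have "a $ 2 * int y = a $ 2 * int y'" unfolding nontrivial_def by linarith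
  then show "y = y'" using assms by simp
next
  assume "nontrivial a x y z" "nontrivial a x y z'"
  then have "a $ 3 * int z = a $ 3 * int z'" unfolding nontrivial_def by linarith
  then show "z = z'" using assms by simp
qed

text \<open>Containers bound the nontrivial solutions, while removal asks for a bound on all of
  them. The difference consists of diagonal triples, whose linear number is negligible against a
  quadratic threshold.\<close>

lemma card_solutions_le:
  assumes "finite A"
  shows "card (solutions a A) \<le> card (nontrivial_solutions a A) + card A"
proof -
  have "solutions a A \<subseteq> nontrivial_solutions a A \<union> (\<lambda>x. (x, x, x)) ` A"
    by (auto simp: solutions_def nontrivial_solutions_def nontrivial_def)
  moreover have "finite (nontrivial_solutions a A)"
    by (rule finite_subset[OF _ finite_solutions[OF assms, of a]])
       (auto simp: solutions_def nontrivial_solutions_def nontrivial_def)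
  ultimately have "card (solutions a A) \<le> card (nontrivial_solutions a A \<union> (\<lambda>x. (x, x, x)) ` A)"
    using assms by (intro card_mono) auto
  also have "\<dots> \<le> card (nontrivial_solutions a A) + card A"
    using card_Un_le card_image_le[OF assms, of "\<lambda>x. (x, x, x)"] by (metis add_left_mono order_trans)
  finally show ?thesis .
qed

text \<open>Sapozhenko's argument: \<open>T\<close> is a largest subset of \<open>I\<close> whose vertices have at least \<open>d\<close> out-neighbours
  on average; by maximality every vertex of \<open>I\<close> has fewer than \<open>d\<close> out-neighbours outside \<open>G `` T\<close>.
  The container depends on \<open>I\<close> only through \<open>T\<close>.\<close>

lemma digraph_container:
  fixes C :: "'a set" and G :: "('a \<times> 'a) set"
  assumes fin: "finite C" and G: "G \<subseteq> C \<times> C" and d: "d > 0"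
    and out: "\<And>y. card (G `` {y}) \<le> s" and inn: "\<And>z. card (G\<inverse> `` {z}) \<le> s"
    and I: "I \<subseteq> C" "\<And>y z. y \<in> I \<Longrightarrow> z \<in> I \<Longrightarrow> (y, z) \<notin> G"
  obtains T where "T \<subseteq> I" "d * card T \<le> card C"
    "I \<subseteq> {y \<in> C - G `` T. card (G `` {y} - G `` T) < d}"
    "card G \<le> d * card C + 2 * s * (card C - card {y \<in> C - G `` T. card (G `` {y} - G `` T) < d})"
proof -
  have finN: "finite (G `` T)" and NC: "G `` T \<subseteq> C" for T
    using G fin by (auto intro: finite_subset[of _ C])
  have finG: "finite G" using G fin by (auto intro: finite_subset)
  define good where "good T \<longleftrightarrow> T \<subseteq> I \<and> d * card T \<le> card (G `` T)" for T
  have finI: "finite I" using I(1) fin by (rule finite_subset)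
  have "\<exists>T. good T \<and> (\<forall>T'. good T' \<longrightarrow> card T' \<le> card T)"
    by (rule ex_has_greatest_nat[of good "{}" card "Suc (card I)"])
       (use finI in \<open>auto simp: good_def less_Suc_eq_le intro: card_mono\<close>)
  then obtain T where T: "good T" "\<And>T'. good T' \<Longrightarrow> card T' \<le> card T" by blast
  have finT: "finite T" using T(1) finI unfolding good_def by (auto intro: finite_subset)
  let ?D = "{y \<in> C - G `` T. card (G `` {y} - G `` T) < d}"
  have few: "card (G `` {y} - G `` T) < d" if y: "y \<in> I" for y
  proof (rule ccontr)
    assume "\<not> ?thesis"
    then have ge: "d \<le> card (G `` {y} - G `` T)" by simp
    have ynT: "y \<notin> T"
    proof
      assume "y \<in> T"
      then have "G `` {y} - G `` T = {}" by blast
      then have "card (G `` {y} - G `` T) = 0" by (simp only: card.empty)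
      then show False using ge d by linarith
    qed
    have "G `` insert y T = (G `` {y} - G `` T) \<union> G `` T" by blast
    then have "card (G `` insert y T) = card (G `` {y} - G `` T) + card (G `` T)"
      using card_Un_disjoint[of "G `` {y} - G `` T" "G `` T"] finN
      by (metis Diff_disjoint finite_Diff inf_commute)
    then have "good (insert y T)"
      using T(1) y ge ynT finT by (simp add: good_def)
    then show False using T(2)[of "insert y T"] ynT finT by simp
  qed
  have sub: "I \<subseteq> ?D"
  proof
    fix y assume y: "y \<in> I"
    have "y \<notin> G `` T" using y I(2) T(1) unfolding good_def by blast
    then show "y \<in> ?D" using y few[OF y] I(1) by blast
  qed
  have DC: "?D \<subseteq> C" by blast
  then have finD: "finite ?D" using fin finite_subset by blast
  \<comment> \<open>An edge that starts in \<open>?D\<close> and ends in the out-neighbourhood of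
    \<open>T\<close> ends outside \<open>?D\<close>. Every edge thus is one of fewer than
    \<open>d\<close> at a vertex of \<open>?D\<close>, or has an endpoint outside \<open>?D\<close>,
    where each vertex pays at most \<open>s\<close> in either direction.\<close>
  have "G \<subseteq> (SIGMA y:?D. G `` {y} - G `` T) \<union> (SIGMA y:C - ?D. G `` {y}) \<union> (SIGMA z:C - ?D. G\<inverse> `` {z})\<inverse>"
    using G by auto
  then have "card G \<le> card ((SIGMA y:?D. G `` {y} - G `` T) \<union> (SIGMA y:C - ?D. G `` {y}) \<union> (SIGMA z:C - ?D. G\<inverse> `` {z})\<inverse>)"
    using fin finD finN finG by (intro card_mono finite_UnI finite_SigmaI) (auto intro!: finite_SigmaI)
  also have "\<dots> \<le> card (SIGMA y:?D. G `` {y} - G `` T) + card (SIGMA y:C - ?D. G `` {y}) + card (SIGMA z:C - ?D. G\<inverse> `` {z})"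
    by (intro order.trans[OF card_Un_le] add_mono order_refl) (simp_all add: card_Un_le)
  also have "\<dots> = (\<Sum>y\<in>?D. card (G `` {y} - G `` T)) + (\<Sum>y\<in>C - ?D. card (G `` {y})) + (\<Sum>z\<in>C - ?D. card (G\<inverse> `` {z}))"
    using fin finD finN finG by (simp add: card_SigmaI)
  also have "\<dots> \<le> (\<Sum>y\<in>?D. d) + (\<Sum>y\<in>C - ?D. s) + (\<Sum>z\<in>C - ?D. s)"
    by (intro add_mono sum_mono out inn) auto
  also have "\<dots> = card ?D * d + 2 * s * (card C - card ?D)"
    using card_Diff_subset[OF finD DC] by simp
  also have "\<dots> \<le> d * card C + 2 * s * (card C - card ?D)"
    using card_mono[OF fin DC] by simp
  finally have "card G \<le> d * card C + 2 * s * (card C - card ?D)" .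
  moreover have "d * card T \<le> card C"
    using T(1) card_mono[OF fin NC[of T]] unfolding good_def by linarith
  ultimately show ?thesis using that T(1) sub unfolding good_def by blast
qed

lemma card_small_subsets_le:
  assumes "finite A"
  shows "card {S. S \<subseteq> A \<and> card S \<le> m} \<le> (card A + 1) ^ m"
proof (induction m)
  case 0
  have "{S. S \<subseteq> A \<and> card S \<le> 0} = {{}}" using assms by (auto dest: finite_subset)
  then show ?case by simp
next
  case (Suc m)
  let ?S = "\<lambda>m. {S. S \<subseteq> A \<and> card S \<le> m}"
  have finS: "finite (?S m)" for m by (rule finite_subset[of _ "Pow A"]) (use assms in auto)
  have "?S (Suc m) \<subseteq> ?S m \<union> (\<lambda>(x, S). insert x S) ` (A \<times> ?S m)"
  proof
    fix S assume S: "S \<in> ?S (Suc m)"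
    show "S \<in> ?S m \<union> (\<lambda>(x, S). insert x S) ` (A \<times> ?S m)"
    proof (cases "card S \<le> m")
      case False
      then have "card S = Suc m" using S by auto
      then obtain x T where T: "S = insert x T" "x \<notin> T" "card T = m" by (auto simp: card_Suc_eq)
      then have "(x, T) \<in> A \<times> ?S m" using S by auto
      then show ?thesis using T(1) by (intro UnI2 image_eqI[of _ _ "(x, T)"]) auto
    qed (use S in auto)
  qed
  then have "card (?S (Suc m)) \<le> card (?S m \<union> (\<lambda>(x, S). insert x S) ` (A \<times> ?S m))"
    using finS assms by (intro card_mono) auto
  also have "\<dots> \<le> card (?S m) + card (A \<times> ?S m)"
    by (intro order.trans[OF card_Un_le] add_left_mono card_image_le) (use finS assms in auto)
  also have "\<dots> = (card A + 1) * card (?S m)" by (simp add: card_cartesian_product)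
  also have "\<dots> \<le> (card A + 1) ^ Suc m"
    unfolding power_Suc by (rule mult_le_mono2[OF Suc.IH])
  finally show ?case .
qed

text \<open>Two entries of a solution determine the third. The union of the links of
  \<open>s\<close> heavy elements therefore has degrees at most \<open>s\<close> but at least
  \<open>s * \<delta> * n / 2\<close> edges. A digraph so dense relative to its degrees has a
  container missing a fixed fraction of \<open>n\<close>.\<close>

lemma container_step:
  fixes a :: "int ^ 3" and C :: "nat set"
  assumes a: "\<forall>i. a $ i \<noteq> 0" and \<delta>: "\<delta> > 0" and C: "C \<subseteq> {1..n}"
    and many: "\<delta> * (real n)\<^sup>2 < real (card (nontrivial_solutions a C))"
    and s: "4 \<le> real s * \<delta>" "4 * real s \<le> \<delta> * real n"
    and m: "s \<le> m" "8 * real n \<le> real m * (real s * \<delta>)"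
  shows "\<exists>\<F>. finite \<F> \<and> card \<F> \<le> (n + 1) ^ (2 * m + 1) \<and>
    (\<forall>F\<in>\<F>. F \<subseteq> C \<and> real (card F) + \<delta> / 8 * real n \<le> real (card C)) \<and>
    (\<forall>I\<subseteq>C. eq_free a I \<longrightarrow> (\<exists>F\<in>\<F>. I \<subseteq> F))"
proof -
  have finC: "finite C" using C finite_subset by blast
  have cardC: "card C \<le> n" using card_mono[OF _ C] by simp
  have n0: "n > 0"
  proof (rule ccontr)
    assume "\<not> n > 0"
    then have "C = {}" using C by auto
    then have "nontrivial_solutions a C = {}" by (auto simp: nontrivial_solutions_def)
    then have "\<delta> * (real n)\<^sup>2 < 0" using many by simp
    then show False using \<delta> by (simp add: mult_less_0_iff)
  qed
  define L where "L x = {(y, z). y \<in> C \<and> z \<in> C \<and> nontrivial a x y z}" for x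
  have L: "L x \<subseteq> C \<times> C" for x by (auto simp: L_def)
  then have finL: "finite (L x)" for x using finC finite_subset by (metis finite_SigmaI)
  have cardL: "card (L x) \<le> n" for x
  proof -
    have "card (L x) \<le> card C"
    proof (rule card_inj_on_le[of fst])
      show "inj_on fst (L x)"
        using nontrivial_unique(3)[OF a] by (auto simp: L_def inj_on_def)
    qed (use finC in \<open>auto simp: L_def\<close>)
    then show ?thesis using cardC by simp
  qed
  \<comment> \<open>The threshold is half of \<open>\<delta> * n\<close>. Light elements then
    contribute at most half of \<open>\<delta> * n^2\<close> solutions and a heavy one at most
    \<open>n\<close>, which leaves at least \<open>\<delta> * n / 2\<close> heavy elements.\<close>
  define H where "H = {x \<in> C. \<delta> * real n / 2 \<le> real (card (L x))}"
  have H: "H \<subseteq> C" "finite H" using finC by (auto simp: H_def)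
  have "nontrivial_solutions a C = (SIGMA x:C. L x)"
    by (auto simp: nontrivial_solutions_def L_def)
  then have "card (nontrivial_solutions a C) = (\<Sum>x\<in>C. card (L x))"
    using finC finL by (simp add: card_SigmaI)
  also have "\<dots> = (\<Sum>x\<in>H. card (L x)) + (\<Sum>x\<in>C - H. card (L x))"
    using sum.subset_diff[OF H(1) finC] by (simp add: add.commute)
  finally have "real (card (nontrivial_solutions a C))
      = (\<Sum>x\<in>H. real (card (L x))) + (\<Sum>x\<in>C - H. real (card (L x)))" by simp
  also have "\<dots> \<le> (\<Sum>x\<in>H. real n) + (\<Sum>x\<in>C - H. \<delta> * real n / 2)"
    using cardL by (intro add_mono sum_mono) (auto simp: H_def)
  also have "\<dots> \<le> real (card H) * real n + real n * (\<delta> * real n / 2)"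
  proof -
    have "card (C - H) \<le> n" using card_mono[OF finC, of "C - H"] cardC by fastforce
    then have "real (card (C - H)) * (\<delta> * real n / 2) \<le> real n * (\<delta> * real n / 2)"
      using \<delta> by (intro mult_right_mono) auto
    then show ?thesis by simp
  qed
  finally have "(\<delta> * real n / 2) * real n \<le> real (card H) * real n"
    using many by (simp add: power2_eq_square algebra_simps)
  then have cardH: "\<delta> * real n / 2 \<le> real (card H)" using n0 by simp
  \<comment> \<open>With a quarter, the edges charged to \<open>d\<close> use up at most half of the
    guaranteed \<open>s * \<delta> * n / 2\<close>. The floor is at least 1, so rounding costs at
    most a factor 2.\<close>
  define d where "d = nat \<lfloor>real s * \<delta> / 4\<rfloor>"
  have d: "d > 0" "real d \<le> real s * \<delta> / 4" "real s * \<delta> \<le> 8 * real d"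
  proof -
    have "1 \<le> \<lfloor>real s * \<delta> / 4\<rfloor>" using s(1) by linarith
    moreover from this have "real d = real_of_int \<lfloor>real s * \<delta> / 4\<rfloor>" by (simp add: d_def)
    ultimately show "d > 0" "real d \<le> real s * \<delta> / 4" "real s * \<delta> \<le> 8 * real d"
      by linarith+
  qed
  have s0: "real s > 0" using s(1) by (cases "s = 0") auto
  \<comment> \<open>If \<open>I\<close> has few vertices of high degree, all other vertices of high degree can be discarded (\<open>F1\<close>).
    Otherwise the links of \<open>s\<close> such vertices form a digraph with many edges and degrees at most \<open>s\<close>
    in which \<open>I\<close> is independent (\<open>F2\<close>).\<close>
  define links where "links S = (\<Union>x\<in>S. L x)" for S
  define F1 where "F1 S = (C - H) \<union> S" for S
  define F2 where "F2 S T = {y \<in> C - links S `` T. card (links S `` {y} - links S `` T) < d}" for S T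
  define \<S> where "\<S> = {S. S \<subseteq> {1..n} \<and> card S \<le> m}"
  have \<S>: "finite \<S>" "card \<S> \<le> (n + 1) ^ m"
    using card_small_subsets_le[of "{1..n}" m] unfolding \<S>_def by auto
  define \<F>0 where "\<F>0 = F1 ` \<S> \<union> (\<lambda>(S, T). F2 S T) ` (\<S> \<times> \<S>)"
  have fin0: "finite \<F>0" using \<S> by (simp add: \<F>0_def)
  have "card \<F>0 \<le> card \<S> + card (\<S> \<times> \<S>)"
    unfolding \<F>0_def using \<S>
    by (intro order.trans[OF card_Un_le] add_mono card_image_le) auto
  also have "\<dots> \<le> (n + 1) ^ m + (n + 1) ^ m * (n + 1) ^ m"
    unfolding card_cartesian_product using \<S> by (intro add_mono mult_le_mono)
  also have "\<dots> \<le> (n + 1) ^ (2 * m + 1)"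
  proof -
    have "(n + 1) ^ m * 1 \<le> (n + 1) ^ m * (n + 1) ^ m" by (intro mult_le_mono2) simp
    then have "(n + 1) ^ m + (n + 1) ^ m * (n + 1) ^ m \<le> 2 * ((n + 1) ^ m * (n + 1) ^ m)" by linarith
    also have "\<dots> \<le> (n + 1) * ((n + 1) ^ m * (n + 1) ^ m)" using n0 by (intro mult_le_mono1) simp
    also have "\<dots> = (n + 1) ^ (2 * m + 1)" by (simp add: power_add mult_2)
    finally show ?thesis .
  qed
  finally have card0: "card \<F>0 \<le> (n + 1) ^ (2 * m + 1)" .
  define \<F> where "\<F> = {F \<in> \<F>0. F \<subseteq> C \<and> real (card F) + \<delta> / 8 * real n \<le> real (card C)}"
  have "\<exists>F\<in>\<F>. I \<subseteq> F" if I: "I \<subseteq> C" "eq_free a I" for I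
  proof (cases "card (I \<inter> H) \<le> s")
    case True
    let ?S = "I \<inter> H"
    have "?S \<in> \<S>" using True m C I by (auto simp: \<S>_def)
    then have "F1 ?S \<in> \<F>0" by (simp add: \<F>0_def)
    moreover have "F1 ?S \<subseteq> C" using I(1) by (auto simp: F1_def)
    moreover have "real (card (F1 ?S)) + \<delta> / 8 * real n \<le> real (card C)"
    proof -
      have "card (F1 ?S) \<le> card (C - H) + s"
        unfolding F1_def using card_Un_le[of "C - H" ?S] True by linarith
      moreover have "card (C - H) = card C - card H" "card H \<le> card C"
        using H finC by (simp_all add: card_Diff_subset card_mono)
      ultimately have "real (card (F1 ?S)) + real (card H) \<le> real (card C) + real s" by linarith
      moreover have "0 \<le> \<delta> * real n" using \<delta> by simp
      ultimately show ?thesis using cardH s(2) by linarith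
    qed
    moreover have "I \<subseteq> F1 ?S" using I(1) by (auto simp: F1_def)
    ultimately show ?thesis by (auto simp: \<F>_def)
  next
    case False
    then obtain S where S: "S \<subseteq> I \<inter> H" "card S = s" "finite S"
      using obtain_subset_with_card_n[of s "I \<inter> H"] by (metis nat_le_linear)
    let ?G = "links S"
    have G: "?G \<subseteq> C \<times> C" using L by (auto simp: links_def)
    have out: "card (?G `` {y}) \<le> s" for y
      unfolding S(2)[symmetric]
      by (rule card_le_if_inj_on_rel[OF S(3), where r = "\<lambda>z x. nontrivial a x y z"])
         (use nontrivial_unique(3)[OF a] in \<open>auto simp: links_def L_def\<close>)
    have inn: "card (?G\<inverse> `` {z}) \<le> s" for z
      unfolding S(2)[symmetric]
      by (rule card_le_if_inj_on_rel[OF S(3), where r = "\<lambda>y x. nontrivial a x y z"])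
         (use nontrivial_unique(2)[OF a] in \<open>auto simp: links_def L_def\<close>)
    have indep: "(y, z) \<notin> ?G" if "y \<in> I" "z \<in> I" for y z
      using that I(2) S(1) by (auto simp: eq_free_iff[OF a] links_def L_def)
    obtain T where T: "T \<subseteq> I" "d * card T \<le> card C" "I \<subseteq> F2 S T"
      "card ?G \<le> d * card C + 2 * s * (card C - card (F2 S T))"
      using digraph_container[OF finC G d(1) out inn I(1) indep] unfolding F2_def by blast
    \<comment> \<open>A pair \<open>(y, z)\<close> lies in the link of at most one \<open>x\<close>,
      so the sizes of the links add up.\<close>
    have "disjoint_family_on L S"
      using nontrivial_unique(1)[OF a] by (auto simp: disjoint_family_on_def L_def)
    then have "card ?G = (\<Sum>x\<in>S. card (L x))"
      unfolding links_def using S(3) finL by (intro card_UN_disjoint) (auto simp: disjoint_family_on_def)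
    then have "real (card ?G) = (\<Sum>x\<in>S. real (card (L x)))" by simp
    also have "\<dots> \<ge> (\<Sum>x\<in>S. \<delta> * real n / 2)"
      using S(1) by (intro sum_mono) (auto simp: H_def)
    finally have G_ge: "real s * (\<delta> * real n / 2) \<le> real (card ?G)" using S(2) by simp
    have F2C: "F2 S T \<subseteq> C" by (auto simp: F2_def)
    have F2_le: "card (F2 S T) \<le> card C" by (rule card_mono[OF finC F2C])
    have "real (card ?G) \<le> real d * real (card C) + 2 * real s * (real (card C) - real (card (F2 S T)))"
      using of_nat_mono[OF T(4), where ?'a = real] F2_le by (simp add: of_nat_diff)
    also have "real d * real (card C) \<le> (real s * \<delta> / 4) * real n"
      using d(2) cardC \<delta> by (intro mult_mono) auto
    finally have "real s * (\<delta> * real n / 2)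
        \<le> (real s * \<delta> / 4) * real n + 2 * real s * (real (card C) - real (card (F2 S T)))"
      using G_ge by linarith
    then have "real s * (\<delta> * real n / 8) \<le> real s * (real (card C) - real (card (F2 S T)))"
      by (simp add: algebra_simps)
    then have size: "real (card (F2 S T)) + \<delta> / 8 * real n \<le> real (card C)"
      using s0 by (simp add: mult_le_cancel_left_pos)
    \<comment> \<open>The fingerprint \<open>T\<close> has at most n/d \<le> 8n/(s\<delta>) \<le> m
      elements.\<close>
    have "real m * (real s * \<delta>) \<ge> 8 * (real d * real (card T))"
      using m(2) T(2) cardC by (metis (mono_tags, opaque_lifting) le_trans mult_le_cancel_left_pos of_nat_le_iff of_nat_mult order_trans zero_less_numeral)
    moreover have "real m * (real s * \<delta>) \<le> real m * (8 * real d)"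
      using d(3) by (intro mult_left_mono) auto
    ultimately have "real d * real (card T) \<le> real d * real m" by (simp add: algebra_simps)
    then have "card T \<le> m" using d(1) by simp
    then have "S \<in> \<S>" "T \<in> \<S>"
      using S T(1) I(1) C m(1) unfolding \<S>_def by blast+
    then have "F2 S T \<in> \<F>0" by (auto simp: \<F>0_def)
    then have "F2 S T \<in> \<F>" using F2C size by (simp add: \<F>_def)
    then show ?thesis using T(3) by blast
  qed
  moreover have "finite \<F>" "card \<F> \<le> (n + 1) ^ (2 * m + 1)"
    using fin0 card0 card_mono[OF fin0, of \<F>] by (auto simp: \<F>_def)
  ultimately show ?thesis by (intro exI[of _ \<F>]) (auto simp: \<F>_def)
qed

text \<open>A container with few nontrivial solutions is left alone; any other is split and loses
  \<open>\<delta> / 8 * n\<close> elements. The size alternative thus becomes impossible once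
  \<open>k * \<delta> / 8\<close> exceeds 1.\<close>

lemma container_iterate:
  fixes a :: "int ^ 3"
  assumes a: "\<forall>i. a $ i \<noteq> 0" and \<delta>: "\<delta> > 0"
    and s: "4 \<le> real s * \<delta>" "4 * real s \<le> \<delta> * real n"
    and m: "s \<le> m" "8 * real n \<le> real m * (real s * \<delta>)"
  shows "\<exists>\<F>. finite \<F> \<and> card \<F> \<le> ((n + 1) ^ (2 * m + 1)) ^ k \<and>
    (\<forall>F\<in>\<F>. F \<subseteq> {1..n} \<and> (real (card (nontrivial_solutions a F)) \<le> \<delta> * (real n)\<^sup>2 \<or>
        real (card F) + real k * (\<delta> / 8 * real n) \<le> real n)) \<and>
    (\<forall>I\<subseteq>{1..n}. eq_free a I \<longrightarrow> (\<exists>F\<in>\<F>. I \<subseteq> F))"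
proof (induction k)
  case 0
  show ?case by (intro exI[of _ "{{1..n}}"]) auto
next
  case (Suc k)
  let ?Q = "(n + 1) ^ (2 * m + 1)"
  let ?few = "\<lambda>F. real (card (nontrivial_solutions a F)) \<le> \<delta> * (real n)\<^sup>2"
  from Suc obtain \<F> where \<F>: "finite \<F>" "card \<F> \<le> ?Q ^ k"
    and parts: "\<forall>F\<in>\<F>. F \<subseteq> {1..n} \<and> (?few F \<or> real (card F) + real k * (\<delta> / 8 * real n) \<le> real n)"
    and cover: "\<forall>I\<subseteq>{1..n}. eq_free a I \<longrightarrow> (\<exists>F\<in>\<F>. I \<subseteq> F)"
    by (elim exE conjE) (rule that)
  have sub: "F \<subseteq> {1..n}" and size: "?few F \<or> real (card F) + real k * (\<delta> / 8 * real n) \<le> real n"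
    if "F \<in> \<F>" for F
    using parts[rule_format, OF that] by simp_all
  \<comment> \<open>The conjunct \<open>\<not> ?few C\<close> is carried along because it selects
    the size alternative of the induction hypothesis for \<open>C\<close>.\<close>
  define refines where "refines C \<G> \<longleftrightarrow> finite \<G> \<and> card \<G> \<le> ?Q \<and>
      (\<forall>F\<in>\<G>. F \<subseteq> C \<and> (?few F \<or> real (card F) + \<delta> / 8 * real n \<le> real (card C) \<and> \<not> ?few C)) \<and>
      (\<forall>I\<subseteq>C. eq_free a I \<longrightarrow> (\<exists>F\<in>\<G>. I \<subseteq> F))" for C \<G>
  have "\<exists>\<G>. refines C \<G>" if C: "C \<in> \<F>" for C
  proof (cases "?few C")
    case True
    have "1 \<le> ?Q" by (rule one_le_power) simp
    then have "card {C} \<le> ?Q" using is_singletonI[of C] unfolding is_singleton_altdef by linarith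
    then show ?thesis using True unfolding refines_def by (intro exI[of _ "{C}"] conjI) auto
  next
    case False
    then have "\<delta> * (real n)\<^sup>2 < real (card (nontrivial_solutions a C))" by simp
    from container_step[OF a \<delta> sub[OF C] this s m] False show ?thesis
      unfolding refines_def by meson
  qed
  then have "\<forall>C\<in>\<F>. \<exists>\<G>. refines C \<G>" by (rule ballI)
  from bchoice[OF this] obtain \<G> where "\<forall>C\<in>\<F>. refines C (\<G> C)" by (rule exE)
  then have ref: "refines C (\<G> C)" if "C \<in> \<F>" for C using that by (rule bspec)
  have \<G>: "finite (\<G> C)" "card (\<G> C) \<le> ?Q" if "C \<in> \<F>" for C
    using ref[OF that] unfolding refines_def by blast+
  have \<G>_sub: "F \<subseteq> C"
    and \<G>_size: "?few F \<or> real (card F) + \<delta> / 8 * real n \<le> real (card C) \<and> \<not> ?few C"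
    if "C \<in> \<F>" "F \<in> \<G> C" for C F
    using ref[OF that(1)] that(2) unfolding refines_def by blast+
  have \<G>_cover: "\<exists>F\<in>\<G> C. I \<subseteq> F" if "C \<in> \<F>" "I \<subseteq> C" "eq_free a I" for C I
    using ref[OF that(1)] that(2,3) unfolding refines_def by blast
  have "card (\<Union>C\<in>\<F>. \<G> C) \<le> (\<Sum>C\<in>\<F>. card (\<G> C))" by (rule card_UN_le[OF \<F>(1)])
  also have "\<dots> \<le> (\<Sum>C\<in>\<F>. ?Q)" by (intro sum_mono \<G>(2))
  also have "\<dots> \<le> ?Q ^ Suc k" using \<F>(2) by simp
  finally have card_UN: "card (\<Union>C\<in>\<F>. \<G> C) \<le> ?Q ^ Suc k" .
  have bounds: "F \<subseteq> {1..n}" "?few F \<or> real (card F) + real (Suc k) * (\<delta> / 8 * real n) \<le> real n"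
    if "C \<in> \<F>" "F \<in> \<G> C" for C F
  proof -
    show "F \<subseteq> {1..n}" using \<G>_sub sub that by blast
    show "?few F \<or> real (card F) + real (Suc k) * (\<delta> / 8 * real n) \<le> real n"
    proof (cases "?few F")
      case False
      then have "real (card F) + \<delta> / 8 * real n \<le> real (card C)" "\<not> ?few C"
        using \<G>_size[OF that] by blast+
      then have "real (card F) + \<delta> / 8 * real n + real k * (\<delta> / 8 * real n) \<le> real n"
        using size[OF that(1)] by linarith
      then show ?thesis unfolding of_nat_Suc distrib_right mult_1 by linarith
    qed blast
  qed
  have all: "\<forall>F\<in>(\<Union>C\<in>\<F>. \<G> C). F \<subseteq> {1..n} \<and>
      (?few F \<or> real (card F) + real (Suc k) * (\<delta> / 8 * real n) \<le> real n)"
  proof (rule ballI, elim UN_E)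
    fix F C assume "C \<in> \<F>" "F \<in> \<G> C"
    from bounds[OF this] show "F \<subseteq> {1..n} \<and>
      (?few F \<or> real (card F) + real (Suc k) * (\<delta> / 8 * real n) \<le> real n)" by (rule conjI)
  qed
  moreover have "\<forall>I\<subseteq>{1..n}. eq_free a I \<longrightarrow> (\<exists>F\<in>(\<Union>C\<in>\<F>. \<G> C). I \<subseteq> F)"
  proof (intro allI impI)
    fix I assume I: "I \<subseteq> {1..n}" "eq_free a I"
    from cover[rule_format, OF I] obtain C where C: "C \<in> \<F>" "I \<subseteq> C" by (rule bexE)
    from \<G>_cover[OF C I(2)] obtain F where F: "F \<in> \<G> C" "I \<subseteq> F" by (rule bexE)
    show "\<exists>F\<in>(\<Union>C\<in>\<F>. \<G> C). I \<subseteq> F"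
    proof (rule bexI)
      show "I \<subseteq> F" by (rule F(2))
      show "F \<in> (\<Union>C\<in>\<F>. \<G> C)" by (rule UN_I[OF C(1)]) (rule F(1))
    qed
  qed
  moreover have "finite (\<Union>C\<in>\<F>. \<G> C)" by (intro finite_UN_I \<F>(1) \<G>(1))
  ultimately show ?case using card_UN all by (intro exI[of _ "\<Union>C\<in>\<F>. \<G> C"] conjI)
qed

theorem containers:
  fixes a :: "int ^ 3"
  assumes a: "\<forall>i. a $ i \<noteq> 0" and \<delta>: "\<delta> > 0" and \<eta>: "\<eta> > 0"
  shows "\<forall>\<^sub>F n in sequentially. \<exists>\<F>. finite \<F> \<and> real (card \<F>) \<le> exp (\<eta> * real n) \<and>
    (\<forall>F\<in>\<F>. F \<subseteq> {1..n} \<and> real (card (nontrivial_solutions a F)) \<le> \<delta> * (real n)\<^sup>2) \<and>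
    (\<forall>I\<subseteq>{1..n}. eq_free a I \<longrightarrow> (\<exists>F\<in>\<F>. I \<subseteq> F))"
proof -
  define k where "k = nat \<lfloor>8 / \<delta>\<rfloor> + 1"
  have "8 / \<delta> < real k" unfolding k_def by linarith
  then have k: "1 < real k * (\<delta> / 8)" using \<delta> by (simp add: field_simps)
  \<comment> \<open>This makes \<open>2 * m + 1 \<le> c * sqrt n\<close>: rounding up
    \<open>s\<close> and \<open>m\<close> adds only constants, absorbed by
    \<open>1 \<le> sqrt n\<close>.\<close>
  define c where "c = 2 * (8 / \<delta> + 3) + 1"
  have c: "c > 0" using \<delta> by (auto simp: c_def intro: add_pos_pos)
  have k0: "real k > 0" by (simp add: k_def)
  have ev1: "\<forall>\<^sub>F n in sequentially. 4 / \<delta> \<le> sqrt (real n)"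
    by (rule filterlim_at_top[THEN iffD1, rule_format]) real_asymp
  have lim2: "((\<lambda>n. (sqrt (real n) + 1) / real n) \<longlongrightarrow> 0) sequentially" by real_asymp
  have ev2: "\<forall>\<^sub>F n in sequentially. (sqrt (real n) + 1) / real n < \<delta> / 4"
    by (rule order_tendstoD(2)[OF lim2]) (use \<delta> in simp)
  have lim3: "((\<lambda>n. sqrt (real n) * ln (real n + 1) / real n) \<longlongrightarrow> 0) sequentially" by real_asymp
  have ev3: "\<forall>\<^sub>F n in sequentially. sqrt (real n) * ln (real n + 1) / real n < \<eta> / (c * real k)"
    by (rule order_tendstoD(2)[OF lim3]) (use \<eta> c k0 in simp)
  show ?thesis
    using ev1 ev2 ev3 eventually_gt_at_top[of 0]
  proof eventually_elim
    case (elim n)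
    \<comment> \<open>The fingerprints need both \<open>s \<le> m\<close> and
      \<open>8 * n / \<delta> \<le> m * s\<close>; \<open>s\<close> of order \<open>sqrt n\<close>
      balances the two and makes \<open>m\<close> of the same order.\<close>
    define s where "s = nat \<lceil>sqrt (real n)\<rceil>"
    define m where "m = s + nat \<lceil>8 / \<delta> * sqrt (real n)\<rceil>"
    have n0: "real n > 0" and r1: "1 \<le> sqrt (real n)" using elim(4) by simp_all
    have s_ge: "sqrt (real n) \<le> real s" and s_le: "real s \<le> sqrt (real n) + 1"
      using r1 unfolding s_def by linarith+
    have e0: "0 \<le> 8 / \<delta> * sqrt (real n)" using \<delta> by simp
    have m_ge: "8 / \<delta> * sqrt (real n) \<le> real m" and m_le: "real m \<le> 8 / \<delta> * sqrt (real n) + 1 + real s"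
      using e0 unfolding m_def by linarith+
    have s1: "4 \<le> real s * \<delta>"
    proof -
      have "4 / \<delta> \<le> real s" using elim(1) s_ge by linarith
      then show ?thesis using \<delta> by (simp add: field_simps)
    qed
    have s2: "4 * real s \<le> \<delta> * real n"
    proof -
      have "sqrt (real n) + 1 < \<delta> / 4 * real n" using elim(2) n0 by (simp add: pos_divide_less_eq)
      then show ?thesis using s_le by linarith
    qed
    have m1: "s \<le> m" by (simp add: m_def)
    have m2: "8 * real n \<le> real m * (real s * \<delta>)"
    proof -
      have "8 * real n = (8 / \<delta> * sqrt (real n)) * (sqrt (real n) * \<delta>)" using \<delta> by simp
      also have "\<dots> \<le> real m * (real s * \<delta>)"
        using m_ge s_ge \<delta> by (intro mult_mono) auto
      finally show ?thesis .
    qed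
    from container_iterate[OF a \<delta> s1 s2 m1 m2, of k]
    obtain \<F> where \<F>: "finite \<F>" "card \<F> \<le> ((n + 1) ^ (2 * m + 1)) ^ k"
      and parts: "\<forall>F\<in>\<F>. F \<subseteq> {1..n} \<and> (real (card (nontrivial_solutions a F)) \<le> \<delta> * (real n)\<^sup>2 \<or>
        real (card F) + real k * (\<delta> / 8 * real n) \<le> real n)"
      and cover: "\<forall>I\<subseteq>{1..n}. eq_free a I \<longrightarrow> (\<exists>F\<in>\<F>. I \<subseteq> F)"
      by (elim exE conjE) (rule that)
    have "real (card F) + real k * (\<delta> / 8 * real n) > real n" for F
    proof -
      have "1 * real n < (real k * (\<delta> / 8)) * real n" using k n0 by (intro mult_strict_right_mono)
      then show ?thesis by simp
    qed
    then have few: "\<forall>F\<in>\<F>. F \<subseteq> {1..n} \<and> real (card (nontrivial_solutions a F)) \<le> \<delta> * (real n)\<^sup>2"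
      using parts by (meson not_le)
    have "real (card \<F>) \<le> real (n + 1) ^ ((2 * m + 1) * k)"
      using \<F>(2) by (metis of_nat_le_iff of_nat_power power_mult)
    also have "\<dots> = exp (real ((2 * m + 1) * k) * ln (real n + 1))"
      by (subst exp_of_nat_mult) (simp add: add.commute)
    also have "\<dots> \<le> exp (\<eta> * real n)"
    proof (subst exp_le_cancel_iff)
      have "2 * real m + 1 \<le> c * sqrt (real n)"
      proof -
        have "c * sqrt (real n) = 2 * (8 / \<delta> * sqrt (real n)) + 7 * sqrt (real n)"
          by (simp add: c_def algebra_simps)
        then show ?thesis using m_le s_le r1 by linarith
      qed
      then have "(2 * real m + 1) * real k * ln (real n + 1) \<le> (c * sqrt (real n)) * real k * ln (real n + 1)"
        using n0 by (intro mult_right_mono) auto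
      then have "real ((2 * m + 1) * k) * ln (real n + 1) \<le> (c * sqrt (real n)) * real k * ln (real n + 1)"
        by (simp only: of_nat_mult of_nat_add of_nat_numeral of_nat_1)
      also have "\<dots> = (c * real k) * (sqrt (real n) * ln (real n + 1))" by simp
      also have "\<dots> \<le> (c * real k) * (\<eta> / (c * real k) * real n)"
        using elim(3) n0 c k0 by (intro mult_left_mono) (simp_all add: pos_divide_less_eq)
      also have "\<dots> = \<eta> * real n" using c k0 by simp
      finally show "real ((2 * m + 1) * k) * ln (real n + 1) \<le> \<eta> * real n" .
    qed
    finally have "real (card \<F>) \<le> exp (\<eta> * real n)" .
    then show ?case by (intro exI[of _ \<F>] conjI \<F>(1) few cover)
  qed
qed

subsection \<open>Counting maximal solution-free sets\<close>

definition isolated :: "int ^ 3 \<Rightarrow> nat \<Rightarrow> nat set" where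
  "isolated a n = {x \<in> {1..n}. \<not> (\<exists>M. eq_triple a M \<and> set_mset M \<subseteq> {1..n} \<and> x \<in># M)}"

lemma isolated_not_in_solution:
  assumes "(x, y, z) \<in> solutions a {1..n}"
  shows "x \<notin> isolated a n \<and> y \<notin> isolated a n \<and> z \<notin> isolated a n"
proof -
  have "is_solution a (vector [x, y, z])"
    using assms by (simp add: solutions_def is_solution_def sum_3)
  then have "eq_triple a {#x, y, z#}"
    unfolding eq_triple_def by (intro exI[of _ "vector [x, y, z]"]) simp
  moreover have "set_mset {#x, y, z#} \<subseteq> {1..n}"
    using assms by (auto simp: solutions_def)
  moreover have "x \<in># {#x, y, z#}" "y \<in># {#x, y, z#}" "z \<in># {#x, y, z#}" by simp_all
  ultimately show ?thesis unfolding isolated_def by blast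
qed

lemma nontrivial_in_solutions:
  "nontrivial a x y z \<Longrightarrow> x \<in> A \<Longrightarrow> y \<in> A \<Longrightarrow> z \<in> A \<Longrightarrow> (x, y, z) \<in> solutions a A"
  by (simp add: nontrivial_def solutions_def)

lemma eq_free_subset:
  "\<forall>i. a $ i \<noteq> 0 \<Longrightarrow> eq_free a B \<Longrightarrow> A \<subseteq> B \<Longrightarrow> eq_free a A"
  unfolding eq_free_iff by blast

lemma eq_free_Un_isolated:
  assumes a: "\<forall>i. a $ i \<noteq> 0" and A: "A \<subseteq> {1..n}" "eq_free a A"
  shows "eq_free a (A \<union> isolated a n)"
  unfolding eq_free_iff[OF a]
proof (intro ballI notI)
  fix x y z assume in_un: "x \<in> A \<union> isolated a n" "y \<in> A \<union> isolated a n" "z \<in> A \<union> isolated a n"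
    and nt: "nontrivial a x y z"
  have "A \<union> isolated a n \<subseteq> {1..n}" using A(1) by (auto simp: isolated_def)
  then have "(x, y, z) \<in> solutions a {1..n}"
    using in_un by (intro nontrivial_in_solutions[OF nt]) blast+
  from isolated_not_in_solution[OF this] have "x \<in> A" "y \<in> A" "z \<in> A" using in_un by blast+
  then show False using A(2) nt unfolding eq_free_iff[OF a] by blast
qed

lemma isolated_subset_maximal:
  assumes a: "\<forall>i. a $ i \<noteq> 0" and M: "maximal_eq_free a n M"
  shows "isolated a n \<subseteq> M"
proof (rule ccontr)
  assume "\<not> isolated a n \<subseteq> M"
  then have "M \<subset> M \<union> isolated a n" by blast
  moreover have "M \<subseteq> {1..n}" "eq_free a M" using M by (auto simp: maximal_eq_free_def)
  moreover have "M \<union> isolated a n \<subseteq> {1..n}" using \<open>M \<subseteq> {1..n}\<close> by (auto simp: isolated_def)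
  ultimately show False
    using M eq_free_Un_isolated[OF a, of M n] unfolding maximal_eq_free_def by blast
qed

lemma card_eq_free_le_mu:
  assumes "A \<subseteq> {1..n}" "eq_free a A"
  shows "card A \<le> mu a n"
  unfolding mu_def
proof (rule Max_ge)
  have "{card A |A. A \<subseteq> {1..n} \<and> eq_free a A} \<subseteq> card ` Pow {1..n}" by blast
  then show "finite {card A |A. A \<subseteq> {1..n} \<and> eq_free a A}"
    by (rule finite_subset) simp
qed (use assms in blast)

text \<open>For \<open>v\<close> outside \<open>M\<close>, maximality gives a solution in
  \<open>insert v M\<close>. It uses \<open>v\<close>, has no isolated entry, meets \<open>S\<close>
  because \<open>F - R\<close> has no solution, and is not contained in
  \<open>S \<union> {v}\<close> because \<open>v\<close> has no loop. So exactly one further entry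
  \<open>y\<close> lies in \<open>M \<inter> W\<close>, and it is a neighbour of \<open>v\<close>. A
  looped vertex cannot be added to \<open>S\<close> and is left out of the graph.\<close>

lemma max_indep_of_maximal:
  fixes a :: "int ^ 3"
  assumes a: "\<forall>i. a $ i \<noteq> 0" and F: "F \<subseteq> {1..n}" and B: "solutions a (F - R) = {}"
    and M: "maximal_eq_free a n M" "M \<subseteq> F" "M \<inter> R = S"
    and W: "W = F - R - isolated a n" and E: "E = (\<lambda>y z. \<not> eq_free a (S \<union> {y, z}))"
  shows "M \<inter> W \<in> max_indep E {y \<in> W. \<not> E y y}"
proof -
  have Mfree: "M \<subseteq> {1..n}" "eq_free a M" and Mmax: "\<And>T. T \<subseteq> {1..n} \<Longrightarrow> eq_free a T \<Longrightarrow> \<not> M \<subset> T"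
    using M(1) by (auto simp: maximal_eq_free_def)
  have SM: "S \<subseteq> M" using M(3) by blast
  have pair: "\<not> E y z" if "y \<in> M" "z \<in> M" for y z
    unfolding E not_not by (rule eq_free_subset[OF a Mfree(2)]) (use SM that in blast)
  have "\<exists>y\<in>M \<inter> W. E v y" if v: "v \<in> W" "\<not> E v v" "v \<notin> M" for v
  proof -
    have "v \<in> {1..n}" using v(1) F W by blast
    then have "insert v M \<subseteq> {1..n}" using Mfree(1) by blast
    moreover have "M \<subset> insert v M" using v(3) by blast
    ultimately have "\<not> eq_free a (insert v M)" using Mmax by blast
    then obtain x1 x2 x3 where x: "x1 \<in> insert v M" "x2 \<in> insert v M" "x3 \<in> insert v M"
      and nt: "nontrivial a x1 x2 x3"
      unfolding eq_free_iff[OF a] by blast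
    have "(x1, x2, x3) \<in> solutions a {1..n}"
      using x \<open>insert v M \<subseteq> {1..n}\<close> by (intro nontrivial_in_solutions[OF nt]) blast+
    from isolated_not_in_solution[OF this]
    have niso: "x1 \<notin> isolated a n" "x2 \<notin> isolated a n" "x3 \<notin> isolated a n" by blast+
    have parts: "insert v M \<subseteq> S \<union> isolated a n \<union> insert v (M \<inter> W)"
      using M(2,3) W by blast
    have x': "x1 \<in> S \<union> insert v (M \<inter> W)" "x2 \<in> S \<union> insert v (M \<inter> W)" "x3 \<in> S \<union> insert v (M \<inter> W)"
      using x niso parts by blast+
    have some_v: "x1 = v \<or> x2 = v \<or> x3 = v"
      using x nt Mfree(2) unfolding eq_free_iff[OF a] by blast
    have "insert v (M \<inter> W) \<subseteq> F - R" using v(1) W by blast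
    then have some_S: "x1 \<in> S \<or> x2 \<in> S \<or> x3 \<in> S"
      using x' nontrivial_in_solutions[OF nt, of "F - R"] B by blast
    have no_S: "\<not> {x1, x2, x3} \<subseteq> S \<union> {v}"
      using v(2) nt unfolding E eq_free_iff[OF a] by blast
    then obtain y where y: "y \<in> {x1, x2, x3}" "y \<notin> S" "y \<noteq> v" by blast
    then have "y \<in> M \<inter> W" using x' by blast
    moreover have "v \<notin> S" using v(1) M(3) W by blast
    then have "{x1, x2, x3} \<subseteq> S \<union> {v, y}" using some_v some_S y by auto
    then have "E v y" using nt unfolding E eq_free_iff[OF a] by blast
    ultimately show ?thesis by blast
  qed
  then show ?thesis unfolding max_indep_def using pair by blast
qed

text \<open>A maximal set is recovered from its trace \<open>S\<close> and from
  \<open>M \<inter> W\<close>, as it contains every isolated element. Each trace thus costs one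
  application of the Moon-Moser bound, and \<open>2 ^ card R\<close> counts the traces.\<close>

lemma card_maximal_in_container_le:
  fixes a :: "int ^ 3"
  assumes a: "\<forall>i. a $ i \<noteq> 0" and F: "F \<subseteq> {1..n}" and R: "R \<subseteq> F" and B: "solutions a (F - R) = {}"
  shows "real (card {M. maximal_eq_free a n M \<and> M \<subseteq> F})
       \<le> 2 ^ card R * 3 powr ((real (mu a n) - real (mu_star a n)) / 3)"
proof -
  let ?\<M> = "\<lambda>S. {M. maximal_eq_free a n M \<and> M \<subseteq> F \<and> M \<inter> R = S}"
  let ?b = "3 powr ((real (mu a n) - real (mu_star a n)) / 3)"
  define W where "W = F - R - isolated a n"
  have finF: "finite F" using F finite_subset by blast
  have finR: "finite R" using R finF finite_subset by blast
  have finW: "finite W" using finF by (simp add: W_def)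
  have iso: "isolated a n \<subseteq> {1..n}" "finite (isolated a n)" by (auto simp: isolated_def)
  have "eq_free a (F - R)"
    using B nontrivial_in_solutions[of a _ _ _ "F - R"] unfolding eq_free_iff[OF a] by blast
  then have "eq_free a ((F - R) \<union> isolated a n)"
    using F by (intro eq_free_Un_isolated[OF a]) auto
  moreover have "(F - R) \<union> isolated a n = W \<union> isolated a n" by (auto simp: W_def)
  ultimately have "eq_free a (W \<union> isolated a n)" by (simp only:)
  moreover have "W \<union> isolated a n \<subseteq> {1..n}" using F iso(1) unfolding W_def by blast
  ultimately have "card (W \<union> isolated a n) \<le> mu a n" by (intro card_eq_free_le_mu)
  moreover have "card (W \<union> isolated a n) = card W + mu_star a n"
  proof -
    have "W \<inter> isolated a n = {}" by (auto simp: W_def)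
    moreover have "mu_star a n = card (isolated a n)" by (simp only: mu_star_def isolated_def)
    ultimately show ?thesis
      using finW iso(2) by (simp add: card_Un_disjoint)
  qed
  ultimately have cardW: "real (card W) \<le> real (mu a n) - real (mu_star a n)" by linarith
  have bound: "real (card (?\<M> S)) \<le> ?b" for S
  proof -
    define E where "E y z \<longleftrightarrow> \<not> eq_free a (S \<union> {y, z})" for y z
    define W' where "W' = {y \<in> W. \<not> E y y}"
    have finW': "finite W'" using finW by (simp add: W'_def)
    have "card (?\<M> S) \<le> card (max_indep E W')"
    proof (rule card_inj_on_le[of "\<lambda>M. M \<inter> W"])
      show "inj_on (\<lambda>M. M \<inter> W) (?\<M> S)"
      proof (rule inj_onI)
        have "M = S \<union> isolated a n \<union> (M \<inter> W)" if "M \<in> ?\<M> S" for M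
          using that isolated_subset_maximal[OF a, of n M] unfolding W_def by blast
        then show "M = N" if "M \<in> ?\<M> S" "N \<in> ?\<M> S" "M \<inter> W = N \<inter> W" for M N
          using that by metis
      qed
      show "(\<lambda>M. M \<inter> W) ` ?\<M> S \<subseteq> max_indep E W'"
        using max_indep_of_maximal[OF a F B _ _ _ W_def, of _ S E] unfolding W'_def E_def by blast
    qed (rule finite_max_indep[OF finW'])
    also have "real (card (max_indep E W')) \<le> 3 powr (real (card W') / 3)"
    proof (rule card_max_indep_le[OF finW'])
      show "E y x" if "E x y" for x y using that by (simp add: E_def insert_commute)
    qed (simp add: W'_def)
    also have "\<dots> \<le> ?b"
    proof (rule powr_mono)
      have "real (card W') \<le> real (card W)"
        using finW by (intro of_nat_mono card_mono) (auto simp: W'_def)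
      then have "real (card W') \<le> real (mu a n) - real (mu_star a n)" using cardW by (rule order.trans)
      then show "real (card W') / 3 \<le> (real (mu a n) - real (mu_star a n)) / 3"
        by (rule divide_right_mono) simp
    qed simp
    finally show ?thesis by simp
  qed
  have "{M. maximal_eq_free a n M \<and> M \<subseteq> F} = (\<Union>S\<in>Pow R. ?\<M> S)" by blast
  moreover have "card (\<Union>S\<in>Pow R. ?\<M> S) \<le> (\<Sum>S\<in>Pow R. card (?\<M> S))"
    by (rule card_UN_le) (use finR in simp)
  ultimately have "card {M. maximal_eq_free a n M \<and> M \<subseteq> F} \<le> (\<Sum>S\<in>Pow R. card (?\<M> S))"
    by (simp only:)
  then have "real (card {M. maximal_eq_free a n M \<and> M \<subseteq> F}) \<le> (\<Sum>S\<in>Pow R. real (card (?\<M> S)))"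
    unfolding of_nat_sum[symmetric] by (rule of_nat_mono)
  also have "\<dots> \<le> (\<Sum>S\<in>Pow R. ?b)" by (intro sum_mono bound)
  also have "\<dots> = 2 ^ card R * ?b" using finR by (simp add: card_Pow)
  finally show ?thesis .
qed

lemma f_max_le_eventually:
  fixes a :: "int ^ 3"
  assumes a: "\<forall>i. a $ i \<noteq> 0" and c: "c > 0"
  shows "\<forall>\<^sub>F n in sequentially.
    real (f_max n a) \<le> 3 powr ((real (mu a n) - real (mu_star a n)) / 3 + c * real n)"
proof -
  \<comment> \<open>One half of \<open>c\<close> pays for the traces, using 2 \<le> 3, the other for
    the number of containers, using e \<le> 3.\<close>
  define \<epsilon> where "\<epsilon> = c / 2"
  have \<epsilon>: "\<epsilon> > 0" using c by (simp add: \<epsilon>_def)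
  obtain \<delta> where \<delta>: "\<delta> > 0" and removal: "\<And>n F. F \<subseteq> {1..n} \<Longrightarrow>
      real (card (solutions a F)) \<le> \<delta> * (real n)\<^sup>2 \<Longrightarrow>
      \<exists>R\<subseteq>F. real (card R) \<le> \<epsilon> * real n \<and> solutions a (F - R) = {}"
    using solution_removal[OF a \<epsilon>] by blast
  \<comment> \<open>From here on the at most \<open>n\<close> diagonal solutions fit into the half
    of \<open>\<delta> * n^2\<close> that the containers leave free.\<close>
  have "\<forall>\<^sub>F n in sequentially. 2 / \<delta> \<le> real n"
    by (rule filterlim_at_top[THEN iffD1, rule_format]) (rule filterlim_real_sequentially)
  then show ?thesis
    using containers[OF a half_gt_zero[OF \<delta>] \<epsilon>]
  proof eventually_elim
    case (elim n)
    let ?b = "3 powr ((real (mu a n) - real (mu_star a n)) / 3)"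
    from elim(2) obtain \<F> where \<F>: "finite \<F>" "real (card \<F>) \<le> exp (\<epsilon> * real n)"
      and parts: "\<forall>F\<in>\<F>. F \<subseteq> {1..n} \<and> real (card (nontrivial_solutions a F)) \<le> \<delta> / 2 * (real n)\<^sup>2"
      and cover: "\<forall>I\<subseteq>{1..n}. eq_free a I \<longrightarrow> (\<exists>F\<in>\<F>. I \<subseteq> F)"
      by (elim exE conjE) (rule that)
    have sub: "F \<subseteq> {1..n}" and few: "real (card (nontrivial_solutions a F)) \<le> \<delta> / 2 * (real n)\<^sup>2"
      if "F \<in> \<F>" for F
      using parts[rule_format, OF that] by simp_all
    have "2 / \<delta> * real n \<le> real n * real n" using elim(1) by (intro mult_right_mono) auto
    then have n_le: "real n \<le> \<delta> / 2 * (real n)\<^sup>2" using \<delta> by (simp add: field_simps power2_eq_square)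
    have bound: "real (card {M. maximal_eq_free a n M \<and> M \<subseteq> F}) \<le> 3 powr (\<epsilon> * real n) * ?b"
      if F: "F \<in> \<F>" for F
    proof -
      have "card F \<le> n" using card_mono[OF _ sub[OF F]] by simp
      moreover have "card (solutions a F) \<le> card (nontrivial_solutions a F) + card F"
        by (rule card_solutions_le[OF finite_subset[OF sub[OF F]]]) simp
      ultimately have "real (card (solutions a F)) \<le> \<delta> * (real n)\<^sup>2"
        using few[OF F] n_le by linarith
      from removal[OF sub[OF F] this] obtain R where R: "R \<subseteq> F" "real (card R) \<le> \<epsilon> * real n"
        "solutions a (F - R) = {}" by blast
      have "(2 :: real) ^ card R \<le> 3 ^ card R" by (intro power_mono) auto
      also have "\<dots> = 3 powr real (card R)" by (simp add: powr_realpow)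
      also have "\<dots> \<le> 3 powr (\<epsilon> * real n)" using R(2) by (intro powr_mono) auto
      finally have "2 ^ card R * ?b \<le> 3 powr (\<epsilon> * real n) * ?b" by (intro mult_right_mono) auto
      then show ?thesis
        using card_maximal_in_container_le[OF a sub[OF F] R(1,3)] by linarith
    qed
    have "{S. maximal_eq_free a n S} \<subseteq> (\<Union>F\<in>\<F>. {M. maximal_eq_free a n M \<and> M \<subseteq> F})"
    proof
      fix M assume "M \<in> {S. maximal_eq_free a n S}"
      then have M: "maximal_eq_free a n M" by (rule CollectD)
      then have "M \<subseteq> {1..n}" "eq_free a M" by (simp_all add: maximal_eq_free_def)
      from cover[rule_format, OF this] obtain F where F: "F \<in> \<F>" "M \<subseteq> F" by (rule bexE)
      show "M \<in> (\<Union>F\<in>\<F>. {M. maximal_eq_free a n M \<and> M \<subseteq> F})"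
        by (rule UN_I[OF F(1)]) (simp add: M F(2))
    qed
    moreover have "finite (\<Union>F\<in>\<F>. {M. maximal_eq_free a n M \<and> M \<subseteq> F})"
      by (rule finite_subset[of _ "Pow {1..n}"]) (auto simp: maximal_eq_free_def)
    ultimately have "f_max n a \<le> card (\<Union>F\<in>\<F>. {M. maximal_eq_free a n M \<and> M \<subseteq> F})"
      unfolding f_max_def by (intro card_mono)
    also have "\<dots> \<le> (\<Sum>F\<in>\<F>. card {M. maximal_eq_free a n M \<and> M \<subseteq> F})"
      by (rule card_UN_le[OF \<F>(1)])
    finally have "real (f_max n a) \<le> (\<Sum>F\<in>\<F>. real (card {M. maximal_eq_free a n M \<and> M \<subseteq> F}))"
      unfolding of_nat_sum[symmetric] by (rule of_nat_mono)
    also have "\<dots> \<le> (\<Sum>F\<in>\<F>. 3 powr (\<epsilon> * real n) * ?b)" by (intro sum_mono bound)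
    also have "\<dots> = real (card \<F>) * (3 powr (\<epsilon> * real n) * ?b)" by simp
    also have "\<dots> \<le> 3 powr (\<epsilon> * real n) * (3 powr (\<epsilon> * real n) * ?b)"
    proof (rule mult_right_mono)
      have "1 \<le> ln (3 :: real)" using exp_le ln_ge_iff[of 3 1] by simp
      then have "\<epsilon> * real n * 1 \<le> \<epsilon> * real n * ln 3" using \<epsilon> by (intro mult_left_mono) auto
      then have "exp (\<epsilon> * real n) \<le> 3 powr (\<epsilon> * real n)" by (simp add: powr_def)
      then show "real (card \<F>) \<le> 3 powr (\<epsilon> * real n)" using \<F>(2) by linarith
    qed simp
    also have "\<dots> = 3 powr ((real (mu a n) - real (mu_star a n)) / 3 + c * real n)"
      unfolding powr_add[symmetric] by (simp add: \<epsilon>_def add.commute)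
    finally show ?case .
  qed
qed

theorem theorem4:
  fixes a :: "int ^ 3"
  assumes "\<forall>i. a $ i \<noteq> 0"
  shows "\<exists>g :: nat \<Rightarrow> real. g \<in> o(\<lambda>n. real n) \<and>
    (\<forall>n. real (f_max n a) \<le> 3 powr ((real (mu a n) - real (mu_star a n)) / 3 + g n))"
proof (intro exI conjI allI)
  define e where "e n = (real (mu a n) - real (mu_star a n)) / 3" for n
  \<comment> \<open>This is the smallest non-negative error for which the bound holds at
    \<open>n\<close>, so eventual bounds for each \<open>c\<close> give \<open>g\<close> in o(n).
    The value 0 is for \<open>f_max n a = 0\<close>, where the logarithm carries no
    information.\<close>
  define g where "g n = (if f_max n a = 0 then 0 else max 0 (log 3 (real (f_max n a)) - e n))" for n
  show "g \<in> o(\<lambda>n. real n)"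
  proof (rule landau_o.smallI)
    fix c :: real assume c: "c > 0"
    show "\<forall>\<^sub>F n in sequentially. norm (g n) \<le> c * norm (real n)"
      using f_max_le_eventually[OF assms c]
    proof eventually_elim
      case (elim n)
      have "log 3 (real (f_max n a)) - e n \<le> c * real n" if "f_max n a > 0"
      proof -
        have "log 3 (real (f_max n a)) \<le> log 3 (3 powr (e n + c * real n))"
          using elim that unfolding e_def by (intro log_mono) auto
        then show ?thesis by simp
      qed
      then show ?case using c by (simp add: g_def)
    qed
  qed
  show "real (f_max n a) \<le> 3 powr ((real (mu a n) - real (mu_star a n)) / 3 + g n)" for n
  proof (cases "f_max n a = 0")
    case False
    then have "real (f_max n a) = 3 powr log 3 (real (f_max n a))" by simp
    also have "\<dots> \<le> 3 powr (e n + g n)" using False by (intro powr_mono) (auto simp: g_def)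
    finally show ?thesis by (simp add: e_def)
  qed simp
qed

end
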